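(* Let $\Omega\subset\mathbb{R}^2$ be a bounded simply connected domain with $C^{1,1}$ boundary, let $x_0\in\Omega$, and let $T$ be a biholomorphism from $\Omega$ onto the unit disk with $T(x_0)=T''(x_0)=0$ (so that $x_0$ is a stationary point). Let $a\in\mathbb{R}\setminus\{0\}$ be the mass of a single point vortex $z(t)$ in $\Omega$. Let $0<\beta<1$. (1) If $|T'''(x_0)|<2|T'(x_0)|^3$, then there exist constants $\varepsilon_0>0$ and $C>0$ such that for every $0<\varepsilon\le\varepsilon_0$ and every initial position $z(0)\in D(x_0,\varepsilon)$, one has $z(t)\in D(x_0,C\varepsilon)$ for all times $t\ge0$, and $\tau_{\varepsilon,\beta}=+\infty$. (2) If $|T'''(x_0)|>2|T'(x_0)|^3$, then there exist constants $\varepsilon_0>0$ and $C>0$ such that for every $0<\varepsilon\le\varepsilon_0$ there exists an initial position $z(0)$ with $|z(0)-x_0|\le\varepsilon$ for which the point vortex exits the disk $D(x_0,\varepsilon^\beta)$ in finite time $\tau_{\varepsilon,\beta}\le C|\ln\varepsilon|$.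
   Context: $\mathbb{R}^2$ is identified with $\mathbb{C}$; $D(x,r)$ is the disk of center $x$ and radius $r$; $T',T'',T'''$ are complex derivatives. The Green's function $G_\Omega$ of $\Omega$ solves $\Delta_xG_\Omega(x,y)=\delta(x-y)$ and vanishes on $\partial\Omega$; $\gamma_\Omega(x,y)=G_\Omega(x,y)-\frac1{2\pi}\ln|x-y|$ is smooth on $\Omega\times\Omega$, and the Robin function is $\widetilde\gamma_\Omega(x)=\gamma_\Omega(x,x)$. A single point vortex of mass $a$ moves according to the ODE $z'(t)=\frac a2\nabla^\perp\widetilde\gamma_\Omega(z(t))$, where $(v_1,v_2)^\perp=(-v_2,v_1)$; its solutions are global in time and stay in $\Omega$. A point $x_0$ is stationary if it is an equilibrium of this ODE, i.e. $\nabla\widetilde\gamma_\Omega(x_0)=0$. The exit time of the point vortex is $\tau_{\varepsilon,\beta}=\sup\{t\ge0:\ \forall s\in[0,t],\ |z(s)-x_0|\le\varepsilon^\beta\}\in[0,+\infty]$. *)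

theory Defs
  imports "HOL-Complex_Analysis.Complex_Analysis"
begin

text \<open>The plane is the type \<^typ>\<open>complex\<close>, regarded as a real Euclidean space with
  \<^prop>\<open>Basis = {1, \<i>}\<close>. Functions on a domain are total functions of which only the values
  on the domain matter.\<close>

text \<open>Meant for open \<open>S\<close> in a finite-dimensional space: there, continuity of all iterated
  directional derivatives of order at most \<open>k\<close> is the usual class $C^k$.\<close>

primrec Ck_on ::
  "nat \<Rightarrow> 'a::real_normed_vector set \<Rightarrow> ('a \<Rightarrow> 'b::real_normed_vector) \<Rightarrow> bool" where
  "Ck_on 0 S f \<longleftrightarrow> continuous_on S f"
| "Ck_on (Suc k) S f \<longleftrightarrow>
     (\<forall>x\<in>S. f differentiable (at x)) \<and>
     (\<forall>v. Ck_on k S (\<lambda>x. frechet_derivative f (at x) v))"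

definition smooth_on ::
  "'a::real_normed_vector set \<Rightarrow> ('a \<Rightarrow> 'b::real_normed_vector) \<Rightarrow> bool" where
  "smooth_on S f \<longleftrightarrow> (\<forall>k. Ck_on k S f)"

definition grad :: "('a::euclidean_space \<Rightarrow> real) \<Rightarrow> 'a \<Rightarrow> 'a" where
  "grad f x = (\<Sum>b\<in>Basis. frechet_derivative f (at x) b *\<^sub>R b)"

definition laplacian :: "('a::euclidean_space \<Rightarrow> real) \<Rightarrow> 'a \<Rightarrow> real" where
  "laplacian f x =
     (\<Sum>b\<in>Basis. frechet_derivative (\<lambda>y. frechet_derivative f (at y) b) (at x) b)"

definition perp :: "complex \<Rightarrow> complex" where
  "perp v = Complex (- Im v) (Re v)"

text \<open>Near each boundary point \<open>p\<close>, in the coordinates with origin \<open>p\<close> and first axis along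
  the unit vector \<open>u\<close>, the domain is the set strictly above the graph of a $C^{1,1}$
  function \<open>f\<close>.\<close>

definition C11_boundary :: "complex set \<Rightarrow> bool" where
  "C11_boundary \<Omega> \<longleftrightarrow>
     (\<forall>p\<in>frontier \<Omega>. \<exists>r>0. \<exists>u f f' L.
        cmod u = 1 \<and>
        (\<forall>s. (f has_real_derivative f' s) (at s)) \<and>
        L-lipschitz_on UNIV f' \<and>
        (\<forall>x\<in>ball p r. x \<in> \<Omega> \<longleftrightarrow> f (Re ((x - p) / u)) < Im ((x - p) / u)))"

definition biholomorphism :: "(complex \<Rightarrow> complex) \<Rightarrow> complex set \<Rightarrow> complex set \<Rightarrow> bool" where
  "biholomorphism T A B \<longleftrightarrow>
     T holomorphic_on A \<and> bij_betw T A B \<and> inv_into A T holomorphic_on B"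

definition test_function :: "complex set \<Rightarrow> (complex \<Rightarrow> real) \<Rightarrow> bool" where
  "test_function \<Omega> \<phi> \<longleftrightarrow>
     smooth_on UNIV \<phi> \<and> compact (closure {x. \<phi> x \<noteq> 0}) \<and> closure {x. \<phi> x \<noteq> 0} \<subseteq> \<Omega>"

text \<open>The equation $\Delta_x G(x,y) = \delta(x-y)$ is meant in the sense of distributions on
  \<open>\<Omega>\<close>; the boundary condition is attained continuously.\<close>

definition green_function :: "complex set \<Rightarrow> (complex \<Rightarrow> complex \<Rightarrow> real) \<Rightarrow> bool" where
  "green_function \<Omega> G \<longleftrightarrow>
     (\<forall>y\<in>\<Omega>.
        (\<forall>K. compact K \<and> K \<subseteq> \<Omega> \<longrightarrow> set_integrable lborel K (\<lambda>x. G x y)) \<and>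
        (\<forall>\<phi>. test_function \<Omega> \<phi> \<longrightarrow>
           set_lebesgue_integral lborel \<Omega> (\<lambda>x. G x y * laplacian \<phi> x) = \<phi> y) \<and>
        continuous_on (closure \<Omega> - {y}) (\<lambda>x. G x y) \<and>
        (\<forall>x\<in>frontier \<Omega>. G x y = 0))"

text \<open>The formula for the regular part only makes sense off the diagonal; the values on the
  diagonal are those of the smooth extension to \<open>\<Omega> \<times> \<Omega>\<close>, hence unique.\<close>

definition regular_part ::
  "complex set \<Rightarrow> (complex \<Rightarrow> complex \<Rightarrow> real) \<Rightarrow> (complex \<Rightarrow> complex \<Rightarrow> real) \<Rightarrow> bool" where
  "regular_part \<Omega> G \<gamma> \<longleftrightarrow>
     smooth_on (\<Omega> \<times> \<Omega>) (\<lambda>(x, y). \<gamma> x y) \<and>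
     (\<forall>x\<in>\<Omega>. \<forall>y\<in>\<Omega>. x \<noteq> y \<longrightarrow> \<gamma> x y = G x y - 1 / (2 * pi) * ln (cmod (x - y)))"

definition robin :: "(complex \<Rightarrow> complex \<Rightarrow> real) \<Rightarrow> complex \<Rightarrow> real" where
  "robin \<gamma> x = \<gamma> x x"

definition stationary_point :: "(complex \<Rightarrow> complex \<Rightarrow> real) \<Rightarrow> complex \<Rightarrow> bool" where
  "stationary_point \<gamma> x \<longleftrightarrow> grad (robin \<gamma>) x = 0"

text \<open>Solutions are global forward in time and stay in \<open>\<Omega>\<close>. The derivative at time 0 is
  one-sided.\<close>

definition point_vortex ::
  "complex set \<Rightarrow> (complex \<Rightarrow> complex \<Rightarrow> real) \<Rightarrow> real \<Rightarrow> (real \<Rightarrow> complex) \<Rightarrow> bool" where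
  "point_vortex \<Omega> \<gamma> a z \<longleftrightarrow>
     (\<forall>t\<ge>0. z t \<in> \<Omega> \<and>
        (z has_vector_derivative (a / 2) *\<^sub>R perp (grad (robin \<gamma>) (z t))) (at t within {0..}))"

definition exit_time :: "complex \<Rightarrow> (real \<Rightarrow> complex) \<Rightarrow> real \<Rightarrow> real \<Rightarrow> ennreal" where
  "exit_time x0 z \<epsilon> \<beta> =
     Sup {ennreal t | t. 0 \<le> t \<and> (\<forall>s\<in>{0..t}. cmod (z s - x0) \<le> \<epsilon> powr \<beta>)}"

end

theory Submission
  imports Defs
begin

text \<open>
  A single vortex moves along the level curves of the Robin function, so the theorem is a
  statement about the shape of that function near \<open>x0\<close>.

  The Robin function is explicit: it equals \<open>(ln \<bar>T'\<bar> - ln (1 - \<bar>T\<bar>\<^sup>2)) / (2 \<pi>)\<close>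
  (\<open>robin_eq\<close>). Fix a pole \<open>y\<close>. Since \<open>\<gamma>\<close> is smooth, \<open>G(\<cdot>, y)\<close> is $C^2$ off \<open>y\<close>, and testing the
  distributional equation against bump functions that avoid \<open>y\<close> shows that it is classically
  harmonic there (\<open>weakly_harmonic_imp_harmonic\<close>). The logarithm is harmonic off \<open>y\<close> as well, so
  the Laplacian of \<open>\<gamma>(\<cdot>, y)\<close> vanishes off \<open>y\<close>, and at \<open>y\<close> by continuity
  (\<open>regular_part_harmonic\<close>). The pullback under \<open>T\<close> of the Green's function of the disk has the
  same singularity and the same boundary values, hence the maximum principle identifies the
  two (\<open>regular_part_eq\<close>), and the formula follows on the diagonal.

  Identifying the plane with the complex numbers, \<open>2 \<pi>\<close> times the gradient of the Robin function is
  \<open>F = cnj (T'' / T') + 2 T cnj T' / (1 - \<bar>T\<bar>\<^sup>2)\<close>. It vanishes at \<open>x0\<close>, and its linearization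
  there is \<open>h \<mapsto> 2 m h + cnj (s h)\<close> with \<open>m = \<bar>T'(x0)\<bar>\<^sup>2\<close> and \<open>s = T'''(x0) / T'(x0)\<close>
  (\<open>robin_field_linearization\<close>). This symmetric map has the eigenvalues \<open>2 m + \<bar>s\<bar>\<close> and
  \<open>2 m - \<bar>s\<bar>\<close>, and comparing \<open>\<bar>T'''\<bar>\<close> with \<open>2 \<bar>T'\<bar>\<^sup>3\<close> decides the sign of the second one.

  If it is positive, \<open>x0\<close> is a strict local minimum of the Robin function, which near \<open>x0\<close> exceeds
  its value at \<open>x0\<close> by an amount comparable to \<open>\<bar>x - x0\<bar>\<^sup>2\<close> (\<open>quadratic_bounds_at_elliptic_point\<close>). As the Robin
  function is conserved, a vortex that starts within \<open>\<epsilon>\<close> stays within a fixed multiple of \<open>\<epsilon>\<close>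
  (\<open>trapped_by_conserved_quantity\<close>).

  If it is negative, \<open>x0\<close> is a saddle. Let \<open>w\<close> be the displacement from \<open>x0\<close>. For a suitable
  unimodular \<open>\<eta>\<close> and some \<open>c > 0\<close> the function \<open>Im (\<eta> w\<^sup>2)\<close> increases, as long as \<open>w\<close> is small, at a rate of at least \<open>2 c \<bar>w\<bar>\<^sup>2\<close>, and hence
  at least \<open>2 c\<close> times its own value (\<open>saddle_growth\<close>). Starting from the value \<open>\<epsilon>\<^sup>2\<close> it is at least
  \<open>\<epsilon>\<^sup>2 exp (2 c t)\<close>, while it cannot exceed \<open>\<epsilon>\<close> to the power \<open>2 \<beta>\<close> inside the disk of radius
  \<open>\<epsilon> powr \<beta>\<close>. This bounds the exit time by a multiple of \<open>\<bar>ln \<epsilon>\<bar>\<close>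
  (\<open>saddle_escape_time\<close>).

  In the second case a global trajectory with the chosen starting point has to be produced
  (\<open>point_vortex_exists\<close>). The sublevel sets of the Robin function are compact, because by
  Bloch's theorem the conformal radius tends to 0 at the boundary
  (\<open>robin_sublevel_compact\<close>). Cutting the velocity field off outside a neighbourhood of
  one such set makes it bounded and globally Lipschitz, so that a contraction argument gives a
  solution for all times, and conservation of the Robin function confines this solution to the set
  on which the field has not been changed.
\<close>

section \<open>Functions with continuous iterated derivatives\<close>

lemma Ck_on_cong:
  assumes "open S" "\<And>x. x \<in> S \<Longrightarrow> f x = g x"
  shows "Ck_on k S f \<longleftrightarrow> Ck_on k S g"
  using assms(2)
proof (induction k arbitrary: f g)
  case 0
  then show ?case by (simp cong: continuous_on_cong)
next
  case (Suc k)
  have D: "(f has_derivative D) (at x) \<longleftrightarrow> (g has_derivative D) (at x)" if "x \<in> S" for x D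
    using Suc.prems that assms(1)
    by (metis has_derivative_transform_within_open)
  have E: "frechet_derivative f (at x) = frechet_derivative g (at x)" if "x \<in> S" for x
    unfolding frechet_derivative_def using D[OF that] by simp
  have F: "f differentiable (at x) \<longleftrightarrow> g differentiable (at x)" if "x \<in> S" for x
    unfolding differentiable_def using D[OF that] by simp
  have "Ck_on k S (\<lambda>x. frechet_derivative f (at x) v)
      \<longleftrightarrow> Ck_on k S (\<lambda>x. frechet_derivative g (at x) v)" for v
    by (rule Suc.IH) (simp add: E)
  then show ?case using F by simp
qed

lemma Ck_on_imp_continuous_on:
  assumes "Ck_on k S f"
  shows "continuous_on S f"
proof (cases k)
  case 0
  then show ?thesis using assms by simp
next
  case (Suc n)
  then show ?thesis using assms
    by (auto intro!: continuous_at_imp_continuous_on differentiable_imp_continuous_within)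
qed

lemma Ck_on_subset: "Ck_on k S f \<Longrightarrow> S' \<subseteq> S \<Longrightarrow> Ck_on k S' f"
  by (induction k arbitrary: f) (auto intro: continuous_on_subset)

lemma Ck_on_add_scaled:
  assumes "open S" "Ck_on k S f" "Ck_on k S g"
  shows "Ck_on k S (\<lambda>x. f x + c *\<^sub>R g x)"
  using assms(2,3)
proof (induction k arbitrary: f g)
  case (Suc k)
  have "((\<lambda>x. f x + c *\<^sub>R g x) has_derivative
      (\<lambda>v. frechet_derivative f (at x) v + c *\<^sub>R frechet_derivative g (at x) v)) (at x)"
    if "x \<in> S" for x
    using Suc.prems that
    by (intro has_derivative_add has_derivative_scaleR_right frechet_derivative_works[THEN iffD1]) auto
  note D = this
  have "Ck_on k S (\<lambda>x. frechet_derivative (\<lambda>x. f x + c *\<^sub>R g x) (at x) v)" for v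
  proof -
    have "Ck_on k S (\<lambda>x. frechet_derivative f (at x) v + c *\<^sub>R frechet_derivative g (at x) v)"
      using Suc by simp
    moreover have "frechet_derivative f (at x) v + c *\<^sub>R frechet_derivative g (at x) v
        = frechet_derivative (\<lambda>x. f x + c *\<^sub>R g x) (at x) v" if "x \<in> S" for x
      using frechet_derivative_at[OF D[OF that]] by metis
    ultimately show ?thesis by (rule Ck_on_cong[OF assms(1), THEN iffD1, rotated])
  qed
  then show ?case using D by (auto simp: differentiable_def)
qed (simp only: Ck_on.simps, intro continuous_intros)

text \<open>Differentiating \<open>x \<mapsto> f (x, y)\<close> in direction \<open>v\<close> is differentiating \<open>f\<close> in direction
  \<open>(v, 0)\<close>. This turns joint smoothness of the regular part into smoothness for a fixed pole.\<close>

lemma Ck_on_slice: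
  fixes f :: "'a::real_normed_vector \<times> 'b::real_normed_vector \<Rightarrow> 'c::real_normed_vector"
  assumes "open A" "y \<in> B" "Ck_on k (A \<times> B) f"
  shows "Ck_on k A (\<lambda>x. f (x, y))"
  using assms(3)
proof (induction k arbitrary: f)
  case 0
  have "continuous_on A (\<lambda>x. (x, y))" by (intro continuous_intros)
  then show ?case using 0 assms(2) continuous_on_compose2[of "A \<times> B" f A "\<lambda>x. (x, y)"] by auto
next
  case (Suc k)
  have D: "((\<lambda>x. f (x, y)) has_derivative (\<lambda>v. frechet_derivative f (at (x, y)) (v, 0))) (at x)"
    if "x \<in> A" for x
  proof -
    have "(f has_derivative frechet_derivative f (at (x, y))) (at (x, y))"
      using Suc.prems that assms(2) by (auto simp: frechet_derivative_works[THEN iffD1])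
    then show ?thesis
      by (rule has_derivative_compose[rotated]) (auto intro!: derivative_eq_intros)
  qed
  have "Ck_on k A (\<lambda>x. frechet_derivative f (at (x, y)) (v, 0))" for v
    using Suc.prems by (intro Suc.IH) auto
  moreover have "frechet_derivative f (at (x, y)) (v, 0) = frechet_derivative (\<lambda>x. f (x, y)) (at x) v"
    if "x \<in> A" for x v using frechet_derivative_at[OF D[OF that]] by metis
  ultimately have "Ck_on k A (\<lambda>x. frechet_derivative (\<lambda>x. f (x, y)) (at x) v)" for v
    by (rule Ck_on_cong[OF assms(1), THEN iffD1, rotated])
  then show ?case using D by (auto simp: differentiable_def)
qed

section \<open>Bump functions\<close>

lemma smooth_on_if_closed_under_derivatives:
  assumes "P f"
    and "\<And>f v. P f \<Longrightarrow> (\<forall>x\<in>S. f differentiable (at x)) \<and> P (\<lambda>x. frechet_derivative f (at x) v)"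
  shows "smooth_on S f"
proof -
  have "Ck_on k S f" if "P f" for k f using that
  proof (induction k arbitrary: f)
    case 0
    then show ?case using assms(2)
      by (auto intro!: continuous_at_imp_continuous_on differentiable_imp_continuous_within)
  qed (use assms(2) in auto)
  then show ?thesis using assms(1) by (simp add: smooth_on_def)
qed

text \<open>The factor \<open>(1 / t) ^ n\<close> makes the family of all \<open>flat_exp n\<close> closed under
  differentiation up to linear combinations; \<open>flat_exp 0\<close> is the usual smooth function that
  vanishes exactly on the negative half-line and at 0.\<close>

definition flat_exp :: "nat \<Rightarrow> real \<Rightarrow> real" where
  "flat_exp n t = (if 0 < t then exp (- 1 / t) * (1 / t) ^ n else 0)"

lemma flat_exp_tendsto_0: "(flat_exp n \<longlongrightarrow> 0) (at 0)"
proof -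
  have "((\<lambda>t. inverse t ^ n / exp (inverse t)) \<longlongrightarrow> (0::real)) (at_right 0)"
    using tendsto_power_div_exp_0 filterlim_inverse_at_top_right by (rule filterlim_compose)
  then have "(flat_exp n \<longlongrightarrow> 0) (at_right 0)"
    by (rule tendsto_cong[THEN iffD1, rotated])
      (auto simp: eventually_at_right_field flat_exp_def exp_minus field_simps intro!: exI[of _ 1])
  moreover have "(flat_exp n \<longlongrightarrow> 0) (at_left 0)"
    by (rule tendsto_cong[THEN iffD1, rotated, of "\<lambda>_. 0"])
      (auto simp: eventually_at_left_field flat_exp_def intro!: exI[of _ "-1"])
  ultimately show ?thesis by (simp add: filterlim_split_at)
qed

text \<open>At 0 the difference quotient of \<open>flat_exp n\<close> is \<open>flat_exp (n + 1)\<close> itself, which tends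
  to 0 since the exponential beats every power.\<close>

lemma flat_exp_has_derivative:
  "(flat_exp n has_real_derivative flat_exp (n + 2) t - n * flat_exp (n + 1) t) (at t)"
proof -
  consider "t > 0" | "t < 0" | "t = 0" by linarith
  then show ?thesis
  proof cases
    case 1
    have "((\<lambda>t. exp (- 1 / t) * (1 / t) ^ n) has_real_derivative
        exp (- 1 / t) * (1 / t)\<^sup>2 * (1 / t) ^ n
        + exp (- 1 / t) * (real n * (1 / t) ^ (n - 1) * (- ((1 / t)\<^sup>2)))) (at t)"
      using 1 by (auto intro!: derivative_eq_intros simp: power2_eq_square divide_inverse)
    moreover have "real n * (1 / t) ^ (n - 1) * (1 / t)\<^sup>2 = real n * (1 / t) ^ (n + 1)"
      by (cases n) (simp_all add: power2_eq_square)
    then have "exp (- 1 / t) * (1 / t)\<^sup>2 * (1 / t) ^ n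
        + exp (- 1 / t) * (real n * (1 / t) ^ (n - 1) * (- ((1 / t)\<^sup>2)))
        = flat_exp (n + 2) t - n * flat_exp (n + 1) t"
      using 1 by (simp add: flat_exp_def power2_eq_square algebra_simps)
    ultimately have "((\<lambda>t. exp (- 1 / t) * (1 / t) ^ n) has_real_derivative
        flat_exp (n + 2) t - n * flat_exp (n + 1) t) (at t)" by simp
    then show ?thesis
      by (rule has_field_derivative_transform_within_open[of _ _ _ "{0<..}"])
        (use 1 in \<open>auto simp: flat_exp_def\<close>)
  next
    case 2
    have "((\<lambda>t. 0) has_real_derivative flat_exp (n + 2) t - n * flat_exp (n + 1) t) (at t)"
      using 2 by (auto intro!: derivative_eq_intros simp: flat_exp_def)
    then show ?thesis
      by (rule has_field_derivative_transform_within_open[of _ _ _ "{..<0}"])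
        (use 2 in \<open>auto simp: flat_exp_def\<close>)
  next
    case 3
    have "(\<lambda>h. (flat_exp n (0 + h) - flat_exp n 0) / h) = flat_exp (n + 1)"
      by (auto simp: flat_exp_def fun_eq_iff)
    then show ?thesis using flat_exp_tendsto_0[of "n + 1"] 3
      by (simp add: DERIV_def) (simp add: flat_exp_def)
  qed
qed

text \<open>An algebra that contains the radial bump function and is closed under
  directional derivatives. Smoothness of all its members then follows from differentiability by
  one induction, with no computation of higher derivatives.\<close>

inductive bump_algebra :: "('a::real_inner \<Rightarrow> real) \<Rightarrow> bool" where
  const: "bump_algebra (\<lambda>x. c)"
| inner: "bump_algebra (\<lambda>x. x \<bullet> v)"
| sq: "bump_algebra (\<lambda>x. x \<bullet> x)"
| add: "bump_algebra f \<Longrightarrow> bump_algebra g \<Longrightarrow> bump_algebra (\<lambda>x. f x + g x)"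
| mult: "bump_algebra f \<Longrightarrow> bump_algebra g \<Longrightarrow> bump_algebra (\<lambda>x. f x * g x)"
| flat: "bump_algebra f \<Longrightarrow> bump_algebra (\<lambda>x. flat_exp n (f x))"

lemma bump_algebra_has_derivative:
  assumes "bump_algebra f"
  shows "\<exists>D. (\<forall>x. (f has_derivative D x) (at x)) \<and> (\<forall>v. bump_algebra (\<lambda>x. D x v))"
  using assms
proof induction
  case (const c)
  show ?case
    by (rule exI[of _ "\<lambda>x v. 0"])
      (rule conjI allI has_derivative_const bump_algebra.const)+
next
  case (inner v)
  have "((\<lambda>x. x \<bullet> v) has_derivative (\<lambda>u. u \<bullet> v)) (at x)" for x
    by (rule has_derivative_inner_left[OF has_derivative_ident])
  then show ?case
    by (intro exI[of _ "\<lambda>x u. u \<bullet> v"] conjI allI bump_algebra.const)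
next
  case sq
  have "((\<lambda>x::'a. x \<bullet> x) has_derivative (\<lambda>u. 2 * (x \<bullet> u))) (at x)" for x
    by (rule derivative_eq_intros refl)+ (simp add: inner_commute)
  moreover have "bump_algebra (\<lambda>x::'a. 2 * (x \<bullet> u))" for u
    by (rule bump_algebra.mult[OF bump_algebra.const bump_algebra.inner])
  ultimately show ?case
    by (intro exI[of _ "\<lambda>x u. 2 * (x \<bullet> u)"] conjI allI)
next
  case (add f g)
  then obtain D E where *: "\<And>x. (f has_derivative D x) (at x)" "\<And>v. bump_algebra (\<lambda>x. D x v)"
    "\<And>x. (g has_derivative E x) (at x)" "\<And>v. bump_algebra (\<lambda>x. E x v)" by blast
  show ?case
    by (intro exI[of _ "\<lambda>x v. D x v + E x v"] conjI allI has_derivative_add bump_algebra.add *)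
next
  case (mult f g)
  then obtain D E where *: "\<And>x. (f has_derivative D x) (at x)" "\<And>v. bump_algebra (\<lambda>x. D x v)"
    "\<And>x. (g has_derivative E x) (at x)" "\<And>v. bump_algebra (\<lambda>x. E x v)" by blast
  show ?case
    by (intro exI[of _ "\<lambda>x v. f x * E x v + D x v * g x"] conjI allI has_derivative_mult
        bump_algebra.add bump_algebra.mult mult.hyps *)
next
  case (flat f n)
  then obtain D where D: "\<And>x. (f has_derivative D x) (at x)" "\<And>v. bump_algebra (\<lambda>x. D x v)"
    by blast
  let ?E = "\<lambda>x v. (flat_exp (n + 2) (f x) + (- real n) * flat_exp (n + 1) (f x)) * D x v"
  have "((\<lambda>x. flat_exp n (f x)) has_derivative ?E x) (at x)" for x
    using has_derivative_compose[OF D(1)[of x]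
        flat_exp_has_derivative[of n "f x", unfolded has_field_derivative_def]] by simp
  moreover have "bump_algebra (\<lambda>x. ?E x v)" for v
    by (rule bump_algebra.mult[OF bump_algebra.add[OF bump_algebra.flat[OF flat.hyps]
            bump_algebra.mult[OF bump_algebra.const bump_algebra.flat[OF flat.hyps]]] D(2)])
  ultimately show ?case by (intro exI[of _ ?E] conjI allI)
qed

lemma bump_algebra_smooth_on: "bump_algebra f \<Longrightarrow> smooth_on S f"
proof (rule smooth_on_if_closed_under_derivatives[of bump_algebra])
  fix f :: "'a \<Rightarrow> real" and v assume "bump_algebra f"
  then obtain D where D: "\<forall>x. (f has_derivative D x) (at x)" "\<forall>v. bump_algebra (\<lambda>x. D x v)"
    using bump_algebra_has_derivative by blast
  then have "frechet_derivative f (at x) = D x" for x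
    using frechet_derivative_at by metis
  then show "(\<forall>x\<in>S. f differentiable (at x)) \<and> bump_algebra (\<lambda>x. frechet_derivative f (at x) v)"
    using D by (auto simp: differentiable_def)
qed

text \<open>The bump is \<open>flat_exp 0\<close> composed with \<open>r\<^sup>2 - (dist p x)\<^sup>2\<close>, written out as a polynomial so
  that it is visibly a member of \<open>bump_algebra\<close>.\<close>

lemma bump_test_function:
  assumes "cball p r \<subseteq> U" "0 < r"
  obtains \<phi> where "test_function U \<phi>" "\<And>x. 0 \<le> \<phi> x" "\<And>x. 0 < \<phi> x \<longleftrightarrow> x \<in> ball p r"
proof
  let ?\<phi> = "\<lambda>x. flat_exp 0 ((r\<^sup>2 - p \<bullet> p) + (x \<bullet> (2 *\<^sub>R p) + (-1) * (x \<bullet> x)))"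
  have eq: "(r\<^sup>2 - p \<bullet> p) + (x \<bullet> (2 *\<^sub>R p) + (-1) * (x \<bullet> x)) = r\<^sup>2 - (dist p x)\<^sup>2" for x
    by (simp add: dist_norm power2_norm_eq_inner inner_diff_left inner_diff_right
        inner_commute[of p x])
  show pos: "0 < ?\<phi> x \<longleftrightarrow> x \<in> ball p r" for x
    unfolding eq using assms(2) power_mono_iff[of r "dist p x" 2] by (simp add: flat_exp_def not_le[symmetric])
  show nonneg: "0 \<le> ?\<phi> x" for x by (simp add: flat_exp_def)
  have "{x. ?\<phi> x \<noteq> 0} = ball p r"
  proof (rule set_eqI)
    fix x show "x \<in> {x. ?\<phi> x \<noteq> 0} \<longleftrightarrow> x \<in> ball p r"
      using pos[of x] nonneg[of x] by (simp only: mem_Collect_eq) linarith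
  qed
  moreover have "smooth_on UNIV ?\<phi>"
    by (rule bump_algebra_smooth_on)
      (rule bump_algebra.flat bump_algebra.add bump_algebra.mult bump_algebra.inner bump_algebra.sq
        bump_algebra.const)+
  ultimately show "test_function U ?\<phi>"
    using assms by (simp add: test_function_def)
qed

section \<open>Integration by parts and weakly harmonic functions\<close>

lemma Ck_on_2D:
  assumes "Ck_on 2 S f"
  shows "x \<in> S \<Longrightarrow> (f has_derivative frechet_derivative f (at x)) (at x)"
    and "x \<in> S \<Longrightarrow> ((\<lambda>y. frechet_derivative f (at y) v) has_derivative
          frechet_derivative (\<lambda>y. frechet_derivative f (at y) v) (at x)) (at x)"
    and "continuous_on S f"
    and "continuous_on S (\<lambda>x. frechet_derivative f (at x) v)"
    and "continuous_on S (\<lambda>x. frechet_derivative (\<lambda>y. frechet_derivative f (at y) v) (at x) u)"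
proof -
  have *: "\<forall>x\<in>S. f differentiable at x" "Ck_on (Suc 0) S (\<lambda>x. frechet_derivative f (at x) v)" for v
    using assms by (auto simp: numeral_2_eq_2)
  show "x \<in> S \<Longrightarrow> (f has_derivative frechet_derivative f (at x)) (at x)"
    using *(1) frechet_derivative_works by blast
  show "x \<in> S \<Longrightarrow> ((\<lambda>y. frechet_derivative f (at y) v) has_derivative
          frechet_derivative (\<lambda>y. frechet_derivative f (at y) v) (at x)) (at x)"
    using *(2)[of v] frechet_derivative_works by (simp, blast)
  show "continuous_on S f" using assms by (rule Ck_on_imp_continuous_on)
  show "continuous_on S (\<lambda>x. frechet_derivative f (at x) v)"
    using *(2) by (rule Ck_on_imp_continuous_on)
  show "continuous_on S (\<lambda>x. frechet_derivative (\<lambda>y. frechet_derivative f (at y) v) (at x) u)"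
    using *(2)[of v] by simp
qed

lemma continuous_on_laplacian: "Ck_on 2 S f \<Longrightarrow> continuous_on S (laplacian f)"
  unfolding laplacian_def[abs_def] by (intro continuous_on_sum Ck_on_2D(5))

lemma integrable_compact_support:
  fixes h :: "'a::euclidean_space \<Rightarrow> real"
  assumes "compact K" "continuous_on K h" "\<And>x. x \<notin> K \<Longrightarrow> h x = 0"
  shows "integrable lborel h"
proof -
  have "h = (\<lambda>x. indicator K x *\<^sub>R h x)" using assms(3) by (auto simp: fun_eq_iff indicator_def)
  then show ?thesis using borel_integrable_compact[OF assms(1,2)] by simp
qed

lemma frechet_derivative_eq_0_on_open:
  assumes "open V" "\<And>x. x \<in> V \<Longrightarrow> f x = 0" "x \<in> V"
  shows "frechet_derivative f (at x) v = 0"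
proof -
  have "(f has_derivative (\<lambda>v. 0)) (at x)"
    by (rule has_derivative_transform_within_open[of "\<lambda>x. 0" _ _ _ V]) (use assms in auto)
  then show ?thesis by (metis frechet_derivative_at)
qed

lemma has_real_derivative_along_line:
  fixes f :: "'a::real_normed_vector \<Rightarrow> real"
  assumes "(f has_derivative D) (at (x + t *\<^sub>R b))"
  shows "((\<lambda>t. f (x + t *\<^sub>R b)) has_real_derivative D b) (at t)"
proof -
  have "((\<lambda>t. x + t *\<^sub>R b) has_derivative (\<lambda>h. h *\<^sub>R b)) (at t)"
    by (auto intro!: derivative_eq_intros)
  from has_derivative_compose[OF this assms]
  show ?thesis
    unfolding has_field_derivative_def
    by (rule has_derivative_eq_rhs)
      (simp add: fun_eq_iff linear_scale[OF has_derivative_linear[OF assms]] mult.commute)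
qed

text \<open>The integral of \<open>x \<mapsto> w (c b + x)\<close> does not depend on \<open>c\<close>, by translation invariance of
  Lebesgue measure. Hence all difference quotients of \<open>w\<close> in direction \<open>b\<close> integrate to 0, and they
  converge to the directional derivative, dominated by a constant on a ball.\<close>

lemma integral_directional_derivative_eq_0:
  fixes w :: "'a::euclidean_space \<Rightarrow> real"
  assumes D: "\<And>x. (w has_derivative W x) (at x)" and cont: "continuous_on UNIV (\<lambda>x. W x b)"
    and K: "compact K" "\<And>x. x \<notin> K \<Longrightarrow> w x = 0"
  shows "integrable lborel (\<lambda>x. W x b)" and "integral\<^sup>L lborel (\<lambda>x. W x b) = 0"
proof -
  have W0: "W x b = 0" if "x \<notin> K" for x
  proof -
    have "((\<lambda>x. 0) has_derivative W x) (at x)"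
      by (rule has_derivative_transform_within_open[OF D, of "- K"])
        (use that K compact_imp_closed in \<open>auto simp: open_Compl\<close>)
    then have "W x = (\<lambda>v. 0)" by (rule has_derivative_unique) simp
    then show ?thesis by simp
  qed
  show "integrable lborel (\<lambda>x. W x b)"
    by (rule integrable_compact_support[OF K(1) _ W0]) (auto intro: continuous_on_subset[OF cont])
  have wc: "continuous_on UNIV w"
    using D by (auto intro!: continuous_at_imp_continuous_on has_derivative_continuous)
  have wi: "integrable lborel w"
    by (rule integrable_compact_support[OF K(1) _ K(2)]) (auto intro: continuous_on_subset[OF wc])
  obtain B where B: "\<And>x. x \<in> K \<Longrightarrow> norm x \<le> B"
    using compact_imp_bounded[OF K(1)] by (auto simp: bounded_iff)
  have "bounded ((\<lambda>x. W x b) ` K)"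
    by (intro compact_imp_bounded compact_continuous_image K continuous_on_subset[OF cont]) auto
  then obtain M0 where M0: "\<And>x. x \<in> K \<Longrightarrow> \<bar>W x b\<bar> \<le> M0" by (auto simp: bounded_iff)
  define M where "M = max M0 0"
  have M: "\<bar>W x b\<bar> \<le> M" for x using W0[of x] M0[of x] by (cases "x \<in> K") (auto simp: M_def)
  define c :: "nat \<Rightarrow> real" where "c n = inverse (real (Suc n))" for n
  have c: "0 < c n" "c n \<le> 1" for n by (auto simp: c_def field_simps)
  define q where "q n x = (w (c n *\<^sub>R b + x) - w x) / c n" for n x
  have der: "((\<lambda>t. w (x + t *\<^sub>R b)) has_real_derivative W (x + t *\<^sub>R b) b) (at t)" for x t
    using D by (rule has_real_derivative_along_line)
  have lim: "(\<lambda>n. q n x) \<longlonglongrightarrow> W x b" for x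
  proof -
    have "((\<lambda>h. (w (x + h *\<^sub>R b) - w x) / h) \<longlongrightarrow> W x b) (at 0)"
      using der[of x 0] by (simp add: DERIV_def)
    moreover have "filterlim c (at 0) sequentially"
      using LIMSEQ_inverse_real_of_nat unfolding c_def[abs_def] filterlim_at by simp
    ultimately have "(\<lambda>n. (w (x + c n *\<^sub>R b) - w x) / c n) \<longlonglongrightarrow> W x b"
      by (rule filterlim_compose)
    then show ?thesis by (simp add: q_def add.commute)
  qed
  have bound: "norm (q n x) \<le> M * indicator (cball 0 (B + norm b)) x" for n x
  proof (cases "x \<in> cball 0 (B + norm b)")
    case True
    obtain z where "w (x + c n *\<^sub>R b) - w (x + 0 *\<^sub>R b) = (c n - 0) * W (x + z *\<^sub>R b) b"
      using MVT2[of 0 "c n" "\<lambda>t. w (x + t *\<^sub>R b)" "\<lambda>t. W (x + t *\<^sub>R b) b"] der c(1)[of n] by blast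
    then have "q n x = W (x + z *\<^sub>R b) b" using c(1)[of n] by (simp add: q_def add.commute)
    then show ?thesis using M True by simp
  next
    case False
    have "norm x - norm b \<le> norm (c n *\<^sub>R b + x)"
    proof -
      have "norm x \<le> norm (c n *\<^sub>R b + x) + norm (c n *\<^sub>R b)"
        by (metis add.commute add_diff_cancel norm_triangle_sub norm_minus_commute add_diff_cancel_left')
      moreover have "norm (c n *\<^sub>R b) \<le> norm b" using c[of n] by (simp add: mult_left_le_one_le)
      ultimately show ?thesis by simp
    qed
    then have "c n *\<^sub>R b + x \<notin> K" "x \<notin> K" using False B norm_ge_zero[of b] by fastforce+
    then show ?thesis using False K(2) by (simp add: q_def)
  qed
  have q0: "integral\<^sup>L lborel (q n) = 0" for n
  proof -
    have wm: "w \<in> borel_measurable borel" using wc by (rule borel_measurable_continuous_onI)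
    have "integral\<^sup>L lborel w = integral\<^sup>L (distr lborel borel ((+) (c n *\<^sub>R b))) w"
      by (simp add: lborel_distr_plus)
    also have "\<dots> = integral\<^sup>L lborel (\<lambda>x. w (c n *\<^sub>R b + x))"
      by (rule integral_distr) (use wm in auto)
    finally have eq: "integral\<^sup>L lborel (\<lambda>x. w (c n *\<^sub>R b + x)) = integral\<^sup>L lborel w" by simp
    have "integrable (distr lborel borel ((+) (c n *\<^sub>R b))) w"
      using wi by (simp add: lborel_distr_plus)
    then have "integrable lborel (\<lambda>x. w (c n *\<^sub>R b + x))"
      by (subst (asm) integrable_distr_eq) (use wm in auto)
    then show ?thesis using wi eq unfolding q_def by simp
  qed
  have "(\<lambda>n. integral\<^sup>L lborel (q n)) \<longlonglongrightarrow> integral\<^sup>L lborel (\<lambda>x. W x b)"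
  proof (rule integral_dominated_convergence[where w = "\<lambda>x. M * indicator (cball 0 (B + norm b)) x"])
    show "(\<lambda>x. W x b) \<in> borel_measurable lborel"
      using borel_measurable_continuous_onI[OF cont] by simp
    show "q n \<in> borel_measurable lborel" for n
      unfolding q_def using c(1)[of n]
      by (auto intro!: borel_measurable_continuous_onI continuous_intros continuous_on_compose2[OF wc])
    show "integrable lborel (\<lambda>x. M * indicator (cball 0 (B + norm b)) x :: real)"
      by (intro integrable_mult_right integrable_real_indicator)
        (simp_all only: sets_lborel borel_closed[OF closed_cball] emeasure_bounded_finite[OF bounded_cball])
  qed (use lim bound in auto)
  then show "integral\<^sup>L lborel (\<lambda>x. W x b) = 0"
    using q0 LIMSEQ_unique[of "\<lambda>n. 0::real" 0] by simp
qed

lemma laplacian_complex: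
  fixes f :: "complex \<Rightarrow> real"
  shows "laplacian f x = frechet_derivative (\<lambda>y. frechet_derivative f (at y) 1) (at x) 1
    + frechet_derivative (\<lambda>y. frechet_derivative f (at y) \<i>) (at x) \<i>"
  by (simp add: laplacian_def Basis_complex_def)

text \<open>Off its support \<open>\<phi>\<close> is 0 on an open set. An integral of \<open>F * laplacian \<phi>\<close> thus does
  not depend on the values of \<open>F\<close> there, in particular at the pole of the Green's function.\<close>

lemma laplacian_test_function_eq_0:
  assumes "x \<notin> closure {x. \<phi> x \<noteq> 0}"
  shows "laplacian \<phi> x = 0"
proof -
  let ?V = "- closure {x. \<phi> x \<noteq> 0}"
  have V: "open ?V" by (simp add: open_Compl)
  have "frechet_derivative \<phi> (at x) v = 0" if "x \<in> ?V" for x v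
    by (rule frechet_derivative_eq_0_on_open[OF V _ that])
      (use closure_subset[of "{x. \<phi> x \<noteq> 0}"] in auto)
  then have "frechet_derivative (\<lambda>y. frechet_derivative \<phi> (at y) v) (at x) u = 0" for u v
    using frechet_derivative_eq_0_on_open[OF V, of "\<lambda>y. frechet_derivative \<phi> (at y) v"] assms by auto
  then show ?thesis by (simp add: laplacian_def)
qed

text \<open>The integrand is the sum over the two coordinate directions \<open>b\<close> of the derivative in
  direction \<open>b\<close> of \<open>F \<partial>\<^sub>b \<phi> - \<phi> \<partial>\<^sub>b F\<close>. Extended by 0 outside of \<open>U\<close> this field is
  differentiable on the whole plane with compact support, so each of the derivatives has integral 0.\<close>

lemma green_identity_test_function:
  fixes F \<phi> :: "complex \<Rightarrow> real"
  assumes U: "open U" and F: "Ck_on 2 U F" and \<phi>: "test_function U \<phi>"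
  shows "integral\<^sup>L lborel (\<lambda>x. if x \<in> U then F x * laplacian \<phi> x - \<phi> x * laplacian F x else 0) = 0"
proof -
  define K where "K = closure {x. \<phi> x \<noteq> 0}"
  have K: "compact K" "K \<subseteq> U" using \<phi> by (auto simp: test_function_def K_def)
  have Kopen: "open (- K)" using K(1) by (simp add: open_Compl compact_imp_closed)
  have \<phi>2: "Ck_on 2 UNIV \<phi>" using \<phi> by (auto simp: test_function_def smooth_on_def)
  have \<phi>0: "\<phi> x = 0" if "x \<notin> K" for x
    using that closure_subset[of "{x. \<phi> x \<noteq> 0}"] by (auto simp: K_def)
  have d\<phi>0: "frechet_derivative \<phi> (at x) v = 0" if "x \<notin> K" for x v
    using frechet_derivative_eq_0_on_open[OF Kopen] \<phi>0 that by auto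
  define dF where "dF v x = frechet_derivative F (at x) v" for v x
  define d\<phi> where "d\<phi> v x = frechet_derivative \<phi> (at x) v" for v x
  define ddF where "ddF b v x = frechet_derivative (dF b) (at x) v" for b v x
  define dd\<phi> where "dd\<phi> b v x = frechet_derivative (d\<phi> b) (at x) v" for b v x
  have FD: "(F has_derivative (\<lambda>v. dF v x)) (at x)" "(dF b has_derivative (\<lambda>v. ddF b v x)) (at x)"
    if "x \<in> U" for x b
    using Ck_on_2D(1,2)[OF F that] unfolding dF_def[abs_def] ddF_def by auto
  have \<phi>D: "(\<phi> has_derivative (\<lambda>v. d\<phi> v x)) (at x)" "(d\<phi> b has_derivative (\<lambda>v. dd\<phi> b v x)) (at x)"
    for x b
    using Ck_on_2D(1,2)[OF \<phi>2] unfolding d\<phi>_def[abs_def] dd\<phi>_def by auto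
  have cont: "continuous_on U F" "continuous_on U \<phi>" "continuous_on U (ddF b v)"
    "continuous_on U (dd\<phi> b v)" for b v
    using Ck_on_2D(3,5)[OF F] Ck_on_2D(3,5)[OF Ck_on_subset[OF \<phi>2 subset_UNIV]]
    unfolding ddF_def dd\<phi>_def dF_def[abs_def] d\<phi>_def[abs_def] by auto
  \<comment> \<open>The field in the divergence identity, and its derivative \<open>W\<close>; off \<open>U\<close> both are 0.\<close>
  define w where "w b x = (if x \<in> U then F x * d\<phi> b x - \<phi> x * dF b x else 0)" for b x
  define W where "W b x v = (if x \<in> U then (F x * dd\<phi> b v x + dF v x * d\<phi> b x)
      - (\<phi> x * ddF b v x + d\<phi> v x * dF b x) else 0)" for b x v
  have w0: "w b x = 0" if "x \<notin> K" for b x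
    using \<phi>0 d\<phi>0 that by (simp add: w_def d\<phi>_def)
  have W: "(w b has_derivative W b x) (at x)" for b x
  proof (cases "x \<in> U")
    case True
    have "((\<lambda>x. F x * d\<phi> b x - \<phi> x * dF b x) has_derivative W b x) (at x)"
      unfolding W_def[abs_def] using True
      by (simp only: if_True) (intro has_derivative_diff has_derivative_mult FD \<phi>D)
    then show ?thesis
      by (rule has_derivative_transform_within_open[OF _ U True]) (simp add: w_def)
  next
    case False
    then have "x \<in> - K" using K by auto
    have "((\<lambda>x. 0) has_derivative W b x) (at x)"
      unfolding W_def[abs_def] using False by simp
    then show ?thesis
      by (rule has_derivative_transform_within_open[OF _ Kopen \<open>x \<in> - K\<close>]) (simp add: w0)
  qed
  have Wbb: "W b x b = (if x \<in> U then F x * dd\<phi> b b x - \<phi> x * ddF b b x else 0)" for b x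
    by (simp add: W_def)
  have "continuous_on UNIV (\<lambda>x. W b x b)" for b
  proof -
    have "continuous_on U (\<lambda>x. W b x b)"
      unfolding Wbb by (simp cong: continuous_on_cong) (intro continuous_intros cont)
    moreover have "W b x b = 0" if "x \<in> - K" for x
    proof -
      have "((\<lambda>x. 0) has_derivative W b x) (at x)"
        by (rule has_derivative_transform_within_open[OF W Kopen that]) (simp add: w0)
      then have "W b x = (\<lambda>v. 0)" by (rule has_derivative_unique) simp
      then show ?thesis by simp
    qed
    then have "continuous_on (- K) (\<lambda>x. W b x b)"
      by (intro continuous_on_cong[THEN iffD1, OF refl _ continuous_on_const[of _ 0]]) simp
    ultimately have "continuous_on (U \<union> - K) (\<lambda>x. W b x b)"
      using U Kopen by (intro continuous_on_open_Un)
    moreover have "U \<union> - K = UNIV" using K by auto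
    ultimately show ?thesis by simp
  qed
  note I = integral_directional_derivative_eq_0[OF W this K(1) w0]
  have "integral\<^sup>L lborel (\<lambda>x. W 1 x 1 + W \<i> x \<i>) = 0"
    using I by simp
  moreover have "W 1 x 1 + W \<i> x \<i>
      = (if x \<in> U then F x * laplacian \<phi> x - \<phi> x * laplacian F x else 0)" for x
    unfolding laplacian_complex Wbb dd\<phi>_def ddF_def d\<phi>_def[abs_def] dF_def[abs_def]
    by (simp add: algebra_simps)
  ultimately show ?thesis by simp
qed

text \<open>If the Laplacian did not vanish at \<open>p\<close>, it would have a constant sign on a small disk
  around \<open>p\<close>, and a bump function on this disk would contradict Green's identity.\<close>

lemma weakly_harmonic_imp_harmonic:
  fixes F :: "complex \<Rightarrow> real"
  assumes U: "open U" and F: "Ck_on 2 U F"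
    and weak: "\<And>\<phi>. test_function U \<phi> \<Longrightarrow>
      integral\<^sup>L lborel (\<lambda>x. if x \<in> U then F x * laplacian \<phi> x else 0) = 0"
    and p: "p \<in> U"
  shows "laplacian F p = 0"
proof (rule ccontr)
  assume ne: "laplacian F p \<noteq> 0"
  \<comment> \<open>The sign makes one argument serve for both signs of the Laplacian.\<close>
  define s where "s = sgn (laplacian F p)"
  have cL: "continuous_on U (laplacian F)" using F by (rule continuous_on_laplacian)
  have "continuous_on U (\<lambda>x. s * laplacian F x)" by (intro continuous_intros cL)
  then have "open (U \<inter> (\<lambda>x. s * laplacian F x) -` {0<..})"
    by (intro continuous_open_preimage U open_greaterThan)
  moreover have "U \<inter> (\<lambda>x. s * laplacian F x) -` {0<..} = {x \<in> U. 0 < s * laplacian F x}" by auto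
  ultimately have "open {x \<in> U. 0 < s * laplacian F x}" by simp
  moreover have "p \<in> {x \<in> U. 0 < s * laplacian F x}"
    using p ne by (auto simp: s_def sgn_if)
  ultimately obtain r where r: "0 < r" "cball p r \<subseteq> {x \<in> U. 0 < s * laplacian F x}"
    using open_contains_cball by blast
  then have "cball p r \<subseteq> U" by auto
  from bump_test_function[OF this r(1)] obtain \<phi> where
    \<phi>: "test_function U \<phi>" "\<And>x. 0 \<le> \<phi> x" "\<And>x. 0 < \<phi> x \<longleftrightarrow> x \<in> ball p r" by metis
  have \<phi>0: "\<phi> x = 0" if "x \<notin> ball p r" for x using \<phi>(2,3)[of x] that by linarith
  have \<phi>2: "Ck_on 2 UNIV \<phi>" using \<phi> by (auto simp: test_function_def smooth_on_def)
  define K where "K = closure {x. \<phi> x \<noteq> 0}"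
  have K: "compact K" "K \<subseteq> U" using \<phi> by (auto simp: test_function_def K_def)
  have \<phi>K: "\<phi> x = 0" if "x \<notin> K" for x
    using that closure_subset[of "{x. \<phi> x \<noteq> 0}"] by (auto simp: K_def)
  define h where "h x = (if x \<in> U then \<phi> x * laplacian F x else 0)" for x
  have h0: "h x = 0" if "x \<notin> K" for x using \<phi>K that by (simp add: h_def)
  have hi: "integrable lborel h"
  proof (rule integrable_compact_support[OF K(1) _ h0])
    have "continuous_on K (\<lambda>x. \<phi> x * laplacian F x)"
      using K by (intro continuous_intros continuous_on_subset[OF cL]
          continuous_on_subset[OF Ck_on_2D(3)[OF \<phi>2]]) auto
    then show "continuous_on K h"
      by (rule continuous_on_cong[THEN iffD1, rotated 2]) (use K in \<open>auto simp: h_def\<close>)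
  qed
  have L\<phi>0: "laplacian \<phi> x = 0" if "x \<notin> K" for x
    using that laplacian_test_function_eq_0 unfolding K_def by blast
  define g where "g x = (if x \<in> U then F x * laplacian \<phi> x else 0)" for x
  have gi: "integrable lborel g"
  proof (rule integrable_compact_support[OF K(1)])
    show "g x = 0" if "x \<notin> K" for x using L\<phi>0 that by (simp add: g_def)
    have "continuous_on K (\<lambda>x. F x * laplacian \<phi> x)"
      using K by (intro continuous_intros continuous_on_subset[OF Ck_on_2D(3)[OF F]]
          continuous_on_subset[OF continuous_on_laplacian[OF \<phi>2]]) auto
    then show "continuous_on K g"
      by (rule continuous_on_cong[THEN iffD1, rotated 2]) (use K in \<open>auto simp: g_def\<close>)
  qed
  have "integral\<^sup>L lborel (\<lambda>x. g x - h x) = 0"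
  proof -
    have "g x - h x = (if x \<in> U then F x * laplacian \<phi> x - \<phi> x * laplacian F x else 0)" for x
      by (simp add: g_def h_def)
    then show ?thesis using green_identity_test_function[OF U F \<phi>(1)] by simp
  qed
  moreover have "integral\<^sup>L lborel g = 0" using weak[OF \<phi>(1)] by (simp add: g_def[abs_def])
  ultimately have "integral\<^sup>L lborel (\<lambda>x. s * h x) = 0" using gi hi by simp
  moreover have pos: "0 < s * h x" if "x \<in> ball p r" for x
  proof -
    have x: "x \<in> U" "0 < s * laplacian F x" using subsetD[OF r(2), of x] that by simp_all
    from \<phi>(3)[of x] that have "0 < \<phi> x" by simp
    from mult_pos_pos[OF this x(2)] have "0 < \<phi> x * (s * laplacian F x)" .
    then show ?thesis using x by (simp add: h_def mult.left_commute)
  qed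
  moreover have nn: "0 \<le> s * h x" for x
    using pos[of x] \<phi>0[of x] by (cases "x \<in> ball p r") (simp_all add: h_def)
  ultimately have AE: "AE x in lborel. s * h x = 0"
    using integral_nonneg_eq_0_iff_AE[of lborel "\<lambda>x. s * h x"] hi by simp
  have "AE x in lborel. x \<notin> ball p r"
    using AE by (rule eventually_mono) (use pos in force)
  then have "ball p r \<in> null_sets lborel" by (simp add: AE_iff_null_sets)
  then have "negligible (ball p r)" by (simp add: negligible_iff_null_sets null_sets_completionI)
  then show False using open_not_negligible[of "ball p r"] r(1) by simp
qed

section \<open>The maximum principle\<close>

lemma second_derivative_nonpos_at_local_max:
  fixes f f' :: "real \<Rightarrow> real"
  assumes d: "0 < d" and f: "\<And>t. \<bar>t\<bar> < d \<Longrightarrow> (f has_real_derivative f' t) (at t)"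
    and f': "(f' has_real_derivative l) (at 0)" and max: "\<And>t. \<bar>t\<bar> < d \<Longrightarrow> f t \<le> f 0"
  shows "l \<le> 0"
proof (rule ccontr)
  assume "\<not> l \<le> 0"
  have "f' 0 = 0"
    by (rule DERIV_local_max[OF f[of 0] d]) (use d max in \<open>auto simp: abs_minus_commute\<close>)
  then obtain e where e: "0 < e" "\<And>h. 0 < h \<Longrightarrow> h < e \<Longrightarrow> 0 < f' h"
    using DERIV_pos_inc_right[OF f'] \<open>\<not> l \<le> 0\<close> by auto
  define t where "t = min d e / 2"
  have t: "0 < t" "t < d" "t < e" using d e by (auto simp: t_def)
  have "(f has_real_derivative f' x) (at x)" if "0 \<le> x" "x \<le> t" for x
    using f[of x] that t by simp
  from MVT2[OF t(1) this] obtain z where z: "0 < z" "z < t" "f t - f 0 = (t - 0) * f' z" by blast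
  moreover have "0 < t * f' z" using e(2)[of z] t z by (intro mult_pos_pos) auto
  ultimately have "0 < f t - f 0" by simp
  then show False using max[of t] t by auto
qed

text \<open>Vanishing at the boundary is expressed through compact exhaustion, so that no boundary
  values of \<open>H\<close> are required. If \<open>H p\<close> is not 0, then for a small \<open>\<delta>\<close> the function
  \<open>\<plusminus> H x + \<delta> \<bar>x\<bar>\<^sup>2\<close> has an interior maximum, although its Laplacian is \<open>4 \<delta> > 0\<close>.\<close>

lemma harmonic_eq_0_if_vanishing_at_boundary:
  fixes H :: "complex \<Rightarrow> real"
  assumes S: "open S" "bounded S" and H: "Ck_on 2 S H" and harm: "\<And>x. x \<in> S \<Longrightarrow> laplacian H x = 0"
    and bdry: "\<And>e. 0 < e \<Longrightarrow> \<exists>K. compact K \<and> K \<subseteq> S \<and> (\<forall>x\<in>S - K. \<bar>H x\<bar> < e)"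
    and p: "p \<in> S"
  shows "H p = 0"
proof (rule ccontr)
  assume "H p \<noteq> 0"
  define s where "s = sgn (H p)"
  \<comment> \<open>At \<open>p\<close> the perturbed function is at least \<open>4 e\<close>. Near the boundary it is at most \<open>2 e\<close>: \<open>\<bar>H\<bar>\<close> is below \<open>e\<close> there, and \<open>\<delta>\<close> is chosen such that the perturbation is at most \<open>e\<close>.\<close>
  define e where "e = \<bar>H p\<bar> / 4"
  have e: "0 < e" "s * H p = 4 * e" using \<open>H p \<noteq> 0\<close> by (auto simp: e_def s_def sgn_if)
  have s: "\<bar>s\<bar> = 1" using \<open>H p \<noteq> 0\<close> by (auto simp: s_def sgn_if)
  obtain M where M: "\<And>x. x \<in> S \<Longrightarrow> norm x \<le> M" using S(2) by (auto simp: bounded_iff)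
  define \<delta> where "\<delta> = e / (M\<^sup>2 + 1)"
  have \<delta>: "0 < \<delta>" unfolding \<delta>_def
    using e by (intro divide_pos_pos add_nonneg_pos) simp_all
  have sq: "\<delta> * (x \<bullet> x) \<le> e" if "x \<in> S" for x
  proof -
    have "x \<bullet> x \<le> M\<^sup>2 + 1"
      using power_mono[OF M[OF that] norm_ge_zero, of 2] unfolding power2_norm_eq_inner by linarith
    then have "\<delta> * (x \<bullet> x) \<le> \<delta> * (M\<^sup>2 + 1)" using \<delta> by (intro mult_left_mono) auto
    also have "M\<^sup>2 + 1 \<noteq> 0" using zero_le_power2[of M] by linarith
    then have "\<delta> * (M\<^sup>2 + 1) = e" unfolding \<delta>_def by simp
    finally show ?thesis .
  qed
  define u where "u x = s * H x + \<delta> * (x \<bullet> x)" for x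
  obtain K where K: "compact K" "K \<subseteq> S" "\<And>x. x \<in> S - K \<Longrightarrow> \<bar>H x\<bar> < e"
    using bdry[OF e(1)] by blast
  have "continuous_on S u" unfolding u_def by (intro continuous_intros Ck_on_2D(3)[OF H])
  then have "continuous_on (insert p K) u" by (rule continuous_on_subset) (use K(2) p in simp)
  then have "\<exists>q\<in>insert p K. \<forall>x\<in>insert p K. u x \<le> u q"
    by (intro continuous_attains_sup compact_insert K(1) insert_not_empty)
  then obtain q where q: "q \<in> insert p K" "\<And>x. x \<in> insert p K \<Longrightarrow> u x \<le> u q" by blast
  have qS: "q \<in> S" using q K p by auto
  have up: "4 * e \<le> u p"
    unfolding u_def e(2) using mult_nonneg_nonneg[OF less_imp_le[OF \<delta>] inner_ge_zero[of p]] by linarith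
  have max: "u x \<le> u q" if "x \<in> S" for x
  proof (cases "x \<in> K")
    case True
    then show ?thesis using q by auto
  next
    case False
    then have "s * H x \<le> e"
      using K(3)[of x] that abs_ge_self[of "s * H x"] s by (simp add: abs_mult)
    then have "u x \<le> 2 * e" unfolding u_def using sq[OF that] by linarith
    then show ?thesis using up q(2)[of p] e by auto
  qed
  obtain d where d: "0 < d" "ball q d \<subseteq> S" using S(1) qS open_contains_ball by blast
  have second: "s * frechet_derivative (\<lambda>y. frechet_derivative H (at y) b) (at q) b + 2 * \<delta> \<le> 0"
    if b: "norm b = 1" for b
  proof (rule second_derivative_nonpos_at_local_max[OF d(1),
        where f = "\<lambda>t. u (q + t *\<^sub>R b)"
          and f' = "\<lambda>t. s * frechet_derivative H (at (q + t *\<^sub>R b)) b + 2 * \<delta> * ((q + t *\<^sub>R b) \<bullet> b)"])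
    fix t :: real assume t: "\<bar>t\<bar> < d"
    have in_S: "q + t *\<^sub>R b \<in> S" using d(2) t b by (auto simp: dist_norm subset_eq)
    then show "u (q + t *\<^sub>R b) \<le> u (q + 0 *\<^sub>R b)" using max by simp
    have "(u has_derivative (\<lambda>h. s * frechet_derivative H (at x) h + 2 * \<delta> * (x \<bullet> h))) (at x)"
      if "x \<in> S" for x
      unfolding u_def
      by (rule has_derivative_eq_rhs[OF has_derivative_add[OF
              has_derivative_mult_right[OF Ck_on_2D(1)[OF H that]]
              has_derivative_mult_right[OF has_derivative_inner[OF has_derivative_ident has_derivative_ident]]]])
        (simp add: fun_eq_iff inner_commute)
    from has_real_derivative_along_line[OF this[OF in_S]]
    show "((\<lambda>t. u (q + t *\<^sub>R b)) has_real_derivative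
        s * frechet_derivative H (at (q + t *\<^sub>R b)) b + 2 * \<delta> * ((q + t *\<^sub>R b) \<bullet> b)) (at t)" .
  next
    let ?D = "\<lambda>y. s * frechet_derivative H (at y) b + 2 * \<delta> * (y \<bullet> b)"
    have "(?D has_derivative (\<lambda>h. s * frechet_derivative (\<lambda>y. frechet_derivative H (at y) b) (at q) h
        + 2 * \<delta> * (h \<bullet> b))) (at q)"
      by (intro has_derivative_add has_derivative_mult_right has_derivative_inner_left
          has_derivative_ident Ck_on_2D(2)[OF H qS])
    then have *: "(?D has_derivative (\<lambda>h. s * frechet_derivative (\<lambda>y. frechet_derivative H (at y) b) (at q) h
        + 2 * \<delta> * (h \<bullet> b))) (at (q + 0 *\<^sub>R b))"
      by (simp only: scaleR_zero_left add_0_right)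
    have bb: "b \<bullet> b = 1" using b by (simp only: norm_eq_1)
    show "((\<lambda>t. ?D (q + t *\<^sub>R b)) has_real_derivative
        s * frechet_derivative (\<lambda>y. frechet_derivative H (at y) b) (at q) b + 2 * \<delta>) (at 0)"
      using has_real_derivative_along_line[OF *] by (simp only: bb mult_1_right)
  qed
  have "s * laplacian H q + 4 * \<delta> \<le> 0"
    using second[OF norm_one] second[OF norm_ii] unfolding laplacian_complex distrib_left by linarith
  moreover have "s * laplacian H q = 0" by (simp only: harm[OF qS] mult_zero_right)
  ultimately show False using \<delta> by linarith
qed

section \<open>Logarithms of moduli of holomorphic functions\<close>

lemma laplacian_add_scaled:
  assumes S: "open S" and f: "Ck_on 2 S f" and g: "Ck_on 2 S g" and x: "x \<in> S"
  shows "laplacian (\<lambda>x. f x + c *\<^sub>R g x) x = laplacian f x + c * laplacian g x"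
proof -
  have "frechet_derivative (\<lambda>x. f x + c *\<^sub>R g x) (at y) b
      = frechet_derivative f (at y) b + c *\<^sub>R frechet_derivative g (at y) b" if "y \<in> S" for y b
    using frechet_derivative_at[OF has_derivative_add[OF Ck_on_2D(1)[OF f that]
          has_derivative_scaleR_right[OF Ck_on_2D(1)[OF g that], of c]]] by metis
  note 1 = this
  have "frechet_derivative (\<lambda>y. frechet_derivative (\<lambda>x. f x + c *\<^sub>R g x) (at y) b) (at x) b
      = frechet_derivative (\<lambda>y. frechet_derivative f (at y) b) (at x) b
      + c *\<^sub>R frechet_derivative (\<lambda>y. frechet_derivative g (at y) b) (at x) b" for b
  proof -
    have "((\<lambda>y. frechet_derivative (\<lambda>x. f x + c *\<^sub>R g x) (at y) b) has_derivative
        (\<lambda>h. frechet_derivative (\<lambda>y. frechet_derivative f (at y) b) (at x) h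
      + c *\<^sub>R frechet_derivative (\<lambda>y. frechet_derivative g (at y) b) (at x) h)) (at x)"
      by (rule has_derivative_transform_within_open[OF has_derivative_add[OF Ck_on_2D(2)[OF f x]
              has_derivative_scaleR_right[OF Ck_on_2D(2)[OF g x], of c]] S x])
        (simp only: 1)
    from frechet_derivative_at[OF this, symmetric] show ?thesis by (rule fun_cong)
  qed
  then show ?thesis by (simp add: laplacian_def sum.distrib sum_distrib_left)
qed

text \<open>The complex logarithm has the derivative \<open>f' / f\<close>, and the logarithm of the modulus is its
  real part; the direct computation avoids choosing a branch.\<close>

lemma has_derivative_ln_norm:
  assumes "(f has_field_derivative f') (at x)" "f x \<noteq> (0::complex)"
  shows "((\<lambda>x. ln (cmod (f x))) has_derivative (\<lambda>h. Re (f' / f x * h))) (at x)"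
proof -
  have "((\<lambda>x. cmod (f x)) has_derivative (\<lambda>h. sgn (f x) \<bullet> (f' * h))) (at x)"
    using has_derivative_compose[OF assms(1)[unfolded has_field_derivative_def]
        has_derivative_norm[OF assms(2)]] by (simp only: inner_commute)
  from has_derivative_compose[OF this DERIV_ln[unfolded has_field_derivative_def]]
  have "((\<lambda>x. ln (cmod (f x))) has_derivative
      (\<lambda>h. inverse (cmod (f x)) * (sgn (f x) \<bullet> (f' * h)))) (at x)"
    using assms by simp
  moreover have "inverse (cmod w) * (sgn w \<bullet> v) = Re (v / w)" if "w \<noteq> 0" for v w
  proof -
    have "Re (v / w) = (w \<bullet> v) / (cmod w)\<^sup>2"
      unfolding Re_divide inner_complex_def cmod_power2 by (simp add: mult.commute)
    then show ?thesis
      by (simp add: sgn_div_norm divide_inverse power2_eq_square)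
  qed
  ultimately show ?thesis using assms(2) by (simp add: mult.commute)
qed

lemma Ck_on_Re_holomorphic:
  assumes "open S" "f holomorphic_on S"
  shows "Ck_on k S (\<lambda>x. Re (f x))"
  using assms(2)
proof (induction k arbitrary: f)
  case 0
  then show ?case by (simp only: Ck_on.simps) (intro continuous_on_Re holomorphic_on_imp_continuous_on)
next
  case (Suc k)
  have D: "((\<lambda>x. Re (f x)) has_derivative (\<lambda>v. Re (deriv f x * v))) (at x)" if "x \<in> S" for x
    using holomorphic_derivI[OF Suc.prems assms(1) that]
    by (intro has_derivative_Re) (simp add: has_field_derivative_def)
  have "Ck_on k S (\<lambda>x. Re (deriv f x * v))" for v
    by (rule Suc.IH[OF holomorphic_on_mult[OF holomorphic_deriv[OF Suc.prems assms(1)] holomorphic_on_const]])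
  moreover have "Re (deriv f x * v) = frechet_derivative (\<lambda>x. Re (f x)) (at x) v" if "x \<in> S" for x v
    using frechet_derivative_at[OF D[OF that]] by metis
  ultimately have "Ck_on k S (\<lambda>x. frechet_derivative (\<lambda>x. Re (f x)) (at x) v)" for v
    by (rule Ck_on_cong[OF assms(1), THEN iffD1, rotated])
  then show ?case using D by (auto simp: differentiable_def)
qed

text \<open>The derivative in direction \<open>v\<close> is \<open>Re (q * v)\<close> for the holomorphic function \<open>q = f' / f\<close>,
  so the Laplacian is \<open>Re (q' * 1 * 1) + Re (q' * \<i> * \<i>) = 0\<close>.\<close>

lemma ln_norm_holomorphic_harmonic:
  assumes S: "open S" and f: "f holomorphic_on S" and nz: "\<And>x. x \<in> S \<Longrightarrow> f x \<noteq> 0"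
  shows "Ck_on (Suc k) S (\<lambda>x. ln (cmod (f x)))"
    and "x \<in> S \<Longrightarrow> laplacian (\<lambda>x. ln (cmod (f x))) x = 0"
proof -
  define q where "q x = deriv f x / f x" for x
  have q: "q holomorphic_on S"
    unfolding q_def[abs_def] using nz by (intro holomorphic_intros holomorphic_deriv f S) auto
  have D: "((\<lambda>x. ln (cmod (f x))) has_derivative (\<lambda>v. Re (q x * v))) (at x)" if "x \<in> S" for x
    unfolding q_def using holomorphic_derivI[OF f S that] nz[OF that] by (rule has_derivative_ln_norm)
  have D': "frechet_derivative (\<lambda>x. ln (cmod (f x))) (at x) v = Re (q x * v)" if "x \<in> S" for x v
    using frechet_derivative_at[OF D[OF that]] by metis
  have "Ck_on k S (\<lambda>x. Re (q x * v))" for v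
    by (intro Ck_on_Re_holomorphic holomorphic_intros q S)
  then have "Ck_on k S (\<lambda>x. frechet_derivative (\<lambda>x. ln (cmod (f x))) (at x) v)" for v
    by (rule Ck_on_cong[OF S, THEN iffD1, rotated]) (simp add: D')
  then show "Ck_on (Suc k) S (\<lambda>x. ln (cmod (f x)))" using D by (auto simp: differentiable_def)
  assume x: "x \<in> S"
  have "((\<lambda>y. frechet_derivative (\<lambda>x. ln (cmod (f x))) (at y) v) has_derivative
      (\<lambda>h. Re (deriv q x * h * v))) (at x)" for v
  proof -
    have "((\<lambda>y. Re (q y * v)) has_derivative (\<lambda>h. Re (deriv q x * h * v))) (at x)"
      using holomorphic_derivI[OF q S x]
      by (intro has_derivative_Re has_derivative_mult_left) (simp add: has_field_derivative_def)
    then show ?thesis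
      by (rule has_derivative_transform_within_open[OF _ S x]) (simp add: D')
  qed
  from frechet_derivative_at[OF this, symmetric]
  have "frechet_derivative (\<lambda>y. frechet_derivative (\<lambda>x. ln (cmod (f x))) (at y) v) (at x) u
    = Re (deriv q x * u * v)" for u v by simp
  then show "laplacian (\<lambda>x. ln (cmod (f x))) x = 0" unfolding laplacian_complex by simp
qed

section \<open>The regular part and the Robin function through the conformal map\<close>

lemma one_minus_cnj_mult_neq_0:
  assumes "cmod w < 1" "cmod z \<le> 1"
  shows "1 - cnj w * z \<noteq> 0"
proof
  assume "1 - cnj w * z = 0"
  then have "cmod (cnj w * z) = 1" by simp
  moreover have "cmod (cnj w * z) \<le> cmod w"
    using assms by (simp add: norm_mult mult_right_le_one_le)
  ultimately show False using assms by simp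
qed

lemma norm_Moebius_on_circle:
  assumes "cmod w < 1" "cmod z = 1"
  shows "cmod (Moebius_function 0 w z) = 1"
proof -
  have "cmod (1 - cnj w * z) = cmod (cnj z) * cmod (z - w)"
  proof -
    have "cmod (1 - cnj w * z) = cmod (cnj (1 - cnj w * z))" by (rule complex_mod_cnj[symmetric])
    also have "cnj (1 - cnj w * z) = cnj z * (z - w)"
      using assms(2) complex_norm_square[of z] by (simp add: algebra_simps)
    finally show ?thesis by (simp add: norm_mult)
  qed
  moreover have "1 - cnj w * z \<noteq> 0" using assms by (intro one_minus_cnj_mult_neq_0) auto
  moreover have "z \<noteq> w" using assms by auto
  ultimately show ?thesis using assms
    by (simp add: Moebius_function_simple norm_divide)
qed

text \<open>The modulus of the Moebius function is continuous on the closed disk and equals 1 on the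
  circle. The set where it is at most \<open>exp (- e)\<close> is therefore a compact part of the open disk, and
  outside of it the modulus lies between \<open>exp (- e)\<close> and 1.\<close>

lemma Moebius_compact_exhaustion:
  assumes "cmod w < 1" "0 < e"
  obtains K where "compact K" "K \<subseteq> ball 0 1"
    "\<And>z. z \<in> ball 0 1 - K \<Longrightarrow> \<bar>ln (cmod (Moebius_function 0 w z))\<bar> < e"
proof
  let ?M = "\<lambda>z. cmod (Moebius_function 0 w z)"
  let ?K = "{z \<in> cball 0 1. ?M z \<in> {..exp (- e)}}"
  have c: "continuous_on (cball 0 1) ?M"
    unfolding Moebius_function_simple
    by (intro continuous_intros) (use one_minus_cnj_mult_neq_0[OF assms(1)] in auto)
  have "closed ?K"
    using continuous_closed_preimage[OF c closed_cball closed_atMost[of "exp (- e)"]]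
    by (simp add: vimage_def Int_def)
  then show "compact ?K"
    by (simp add: compact_eq_bounded_closed) (auto simp: bounded_iff intro!: exI[of _ 1])
  show "?K \<subseteq> ball 0 1"
  proof
    fix z assume z: "z \<in> ?K"
    have "cmod z \<noteq> 1"
      using z norm_Moebius_on_circle[OF assms(1), of z] assms(2) by auto
    then show "z \<in> ball 0 1" using z by auto
  qed
  fix z assume z: "z \<in> ball 0 1 - ?K"
  then have lower: "exp (- e) < ?M z" by auto
  have "?M z < 1" using z assms by (intro Moebius_function_norm_lt_1) auto
  moreover have "0 < ?M z" using exp_gt_zero[of "- e"] lower by linarith
  ultimately have "- e < ln (?M z)" "ln (?M z) < 0"
    using lower ln_less_cancel_iff[of "exp (- e)" "?M z"] by simp_all
  then show "\<bar>ln (?M z)\<bar> < e" by simp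
qed

text \<open>The value at \<open>y\<close> removes the singularity; it is this value that appears in the Robin
  function.\<close>

definition diff_quotient :: "(complex \<Rightarrow> complex) \<Rightarrow> complex \<Rightarrow> complex \<Rightarrow> complex" where
  "diff_quotient T y x = (if x = y then deriv T y else (T x - T y) / (x - y))"

text \<open>Only test functions supported away from the pole are used. Their value at the pole is 0,
  so that they express harmonicity of \<open>G(\<cdot>, y)\<close> on the punctured domain, and subtracting the
  logarithm gives the same for the regular part. At the pole the Laplacian of the regular part
  vanishes by continuity.\<close>

lemma regular_part_harmonic:
  assumes \<Omega>: "open \<Omega>" and G: "green_function \<Omega> G" and \<gamma>: "regular_part \<Omega> G \<gamma>"
    and y: "y \<in> \<Omega>"
  shows "Ck_on 2 \<Omega> (\<lambda>x. \<gamma> x y)" and "x \<in> \<Omega> \<Longrightarrow> laplacian (\<lambda>x. \<gamma> x y) x = 0"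
proof -
  have \<gamma>2: "Ck_on 2 (\<Omega> \<times> \<Omega>) (\<lambda>(x, y). \<gamma> x y)"
    and \<gamma>eq: "\<And>x. x \<in> \<Omega> \<Longrightarrow> x \<noteq> y \<Longrightarrow> \<gamma> x y = G x y - 1 / (2 * pi) * ln (cmod (x - y))"
    using \<gamma> y by (auto simp: regular_part_def smooth_on_def)
  show C2: "Ck_on 2 \<Omega> (\<lambda>x. \<gamma> x y)" using Ck_on_slice[OF \<Omega> y \<gamma>2] by simp
  let ?U = "\<Omega> - {y}" and ?l = "\<lambda>x. ln (cmod (x - y))"
  have U: "open ?U" using \<Omega> by (simp add: open_delete)
  have hol: "(\<lambda>x. x - y) holomorphic_on ?U" by (intro holomorphic_intros)
  note l = ln_norm_holomorphic_harmonic[OF U hol]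
  have l2: "Ck_on 2 ?U ?l" using l(1)[of "Suc 0"] by (simp add: numeral_2_eq_2 del: Ck_on.simps)
  have g2: "Ck_on 2 ?U (\<lambda>x. \<gamma> x y)" using Ck_on_subset[OF C2] by auto
  define F where "F x = \<gamma> x y + (1 / (2 * pi)) *\<^sub>R ?l x" for x
  have F2: "Ck_on 2 ?U F" unfolding F_def[abs_def] by (rule Ck_on_add_scaled[OF U g2 l2])
  have zero: "laplacian (\<lambda>x. \<gamma> x y) x = 0" if x: "x \<in> ?U" for x
  proof -
    have "laplacian F x = 0"
    proof (rule weakly_harmonic_imp_harmonic[OF U F2 _ x])
      fix \<phi> assume \<phi>: "test_function ?U \<phi>"
      then have "test_function \<Omega> \<phi>" by (auto simp: test_function_def)
      then have *: "integral\<^sup>L lborel (\<lambda>x. indicator \<Omega> x *\<^sub>R (G x y * laplacian \<phi> x)) = \<phi> y"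
        using G y by (auto simp: green_function_def set_lebesgue_integral_def)
      have ysupp: "y \<notin> closure {x. \<phi> x \<noteq> 0}" using \<phi> by (auto simp: test_function_def)
      then have "\<phi> y = 0" using closure_subset[of "{x. \<phi> x \<noteq> 0}"] by auto
      moreover have "indicator \<Omega> x *\<^sub>R (G x y * laplacian \<phi> x)
          = (if x \<in> ?U then F x * laplacian \<phi> x else 0)" for x
        using laplacian_test_function_eq_0[OF ysupp] \<gamma>eq[of x] by (auto simp: F_def indicator_def)
      ultimately show "integral\<^sup>L lborel (\<lambda>x. if x \<in> ?U then F x * laplacian \<phi> x else 0) = 0"
        using * by simp
    qed
    moreover have "laplacian F x = laplacian (\<lambda>x. \<gamma> x y) x + 1 / (2 * pi) * laplacian ?l x"
      unfolding F_def[abs_def] by (rule laplacian_add_scaled[OF U g2 l2 x])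
    moreover have "laplacian ?l x = 0" using l(2)[OF _ x] by auto
    ultimately show ?thesis by simp
  qed
  have "laplacian (\<lambda>x. \<gamma> x y) y = 0"
  proof -
    have "continuous_on \<Omega> (laplacian (\<lambda>x. \<gamma> x y))" using C2 by (rule continuous_on_laplacian)
    then have "(laplacian (\<lambda>x. \<gamma> x y) \<longlongrightarrow> laplacian (\<lambda>x. \<gamma> x y) y) (at y)"
      using \<Omega> y continuous_on_eq_continuous_at isCont_def by blast
    moreover have "(laplacian (\<lambda>x. \<gamma> x y) \<longlongrightarrow> 0) (at y)"
    proof (rule tendsto_eventually)
      have "\<forall>\<^sub>F x in at y. x \<in> \<Omega>" using \<Omega> y by (rule eventually_at_in_open')
      then show "\<forall>\<^sub>F x in at y. laplacian (\<lambda>x. \<gamma> x y) x = 0"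
        using eventually_neq_at_within[of y] by eventually_elim (use zero in auto)
    qed
    ultimately show ?thesis using tendsto_unique[OF at_neq_bot] by blast
  qed
  then show "x \<in> \<Omega> \<Longrightarrow> laplacian (\<lambda>x. \<gamma> x y) x = 0" using zero by (cases "x = y") auto
qed

lemma diff_quotient_holomorphic:
  "open S \<Longrightarrow> T holomorphic_on S \<Longrightarrow> diff_quotient T y holomorphic_on S"
  unfolding diff_quotient_def[abs_def] by (rule pole_lemma_open)

text \<open>The set of points of the closure outside a small disk around \<open>y\<close> where \<open>\<bar>G\<bar>\<close> is at least
  \<open>e\<close> is compact, and it avoids the boundary, where \<open>G\<close> vanishes.\<close>

lemma green_function_compact_exhaustion:
  assumes "open \<Omega>" "bounded \<Omega>" and G: "green_function \<Omega> G" and y: "y \<in> \<Omega>" and e: "0 < e"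
  obtains K where "compact K" "K \<subseteq> \<Omega>" "y \<in> K" "\<And>x. x \<in> \<Omega> - K \<Longrightarrow> \<bar>G x y\<bar> < e"
proof -
  obtain r where r: "0 < r" "cball y r \<subseteq> \<Omega>" using assms(1) y open_contains_cball by blast
  have c: "continuous_on (closure \<Omega> - {y}) (\<lambda>x. G x y)" and b: "\<And>x. x \<in> frontier \<Omega> \<Longrightarrow> G x y = 0"
    using G y by (auto simp: green_function_def)
  let ?A = "closure \<Omega> - ball y r"
  let ?K1 = "?A \<inter> (\<lambda>x. \<bar>G x y\<bar>) -` {e..}"
  have "continuous_on ?A (\<lambda>x. \<bar>G x y\<bar>)"
    using r(1) by (intro continuous_intros continuous_on_subset[OF c]) auto
  then have "closed ?K1" by (intro continuous_closed_preimage closed_Diff) auto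
  moreover have "bounded ?K1" using assms(2) by (auto intro: bounded_subset[of "closure \<Omega>"])
  ultimately have "compact ?K1" by (simp add: compact_eq_bounded_closed)
  moreover have "?K1 \<subseteq> \<Omega>"
  proof
    fix x assume "x \<in> ?K1"
    then have "x \<in> closure \<Omega>" "G x y \<noteq> 0" using e by auto
    then show "x \<in> \<Omega>" using b[of x] assms(1) by (auto simp: frontier_def interior_open)
  qed
  ultimately show thesis
    using r closure_subset[of \<Omega>] by (intro that[of "cball y r \<union> ?K1"]) (auto simp: not_le)
qed

text \<open>This is conformal invariance of the Green's function: \<open>G x y\<close> is \<open>1 / (2 \<pi>)\<close> times the
  logarithm of the modulus of the Moebius function that sends \<open>T y\<close> to 0, evaluated at \<open>T x\<close>. Dividing
  the argument of the logarithm by \<open>x - y\<close> gives a holomorphic function without zeros on the whole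
  domain. The difference of the two sides is therefore harmonic, including at the pole,
  and it vanishes at the boundary.\<close>

theorem regular_part_eq:
  assumes \<Omega>: "open \<Omega>" "bounded \<Omega>" and G: "green_function \<Omega> G" and \<gamma>: "regular_part \<Omega> G \<gamma>"
    and T: "biholomorphism T \<Omega> (ball 0 1)" and x: "x \<in> \<Omega>" and y: "y \<in> \<Omega>"
  shows "\<gamma> x y = 1 / (2 * pi) * ln (cmod (diff_quotient T y x / (1 - cnj (T y) * T x)))"
proof -
  have hol: "T holomorphic_on \<Omega>" and inj: "inj_on T \<Omega>" and img: "T ` \<Omega> = ball 0 1"
    and hol_inv: "inv_into \<Omega> T holomorphic_on ball 0 1"
    using T by (auto simp: biholomorphism_def bij_betw_def)
  have T1: "cmod (T x) < 1" if "x \<in> \<Omega>" for x using img that by auto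
  define Q where "Q x = diff_quotient T y x / (1 - cnj (T y) * T x)" for x
  have den: "1 - cnj (T y) * T x \<noteq> 0" if "x \<in> \<Omega>" for x
    using T1[OF that] T1[OF y] by (intro one_minus_cnj_mult_neq_0) auto
  have Qhol: "Q holomorphic_on \<Omega>" unfolding Q_def[abs_def]
    by (intro holomorphic_intros diff_quotient_holomorphic hol \<Omega>(1) den)
  have Qnz: "Q x \<noteq> 0" if "x \<in> \<Omega>" for x
    using den[OF that] holomorphic_injective_imp_regular[OF hol \<Omega>(1) inj y] inj_onD[OF inj _ that y]
    by (auto simp: Q_def diff_quotient_def)
  note lnQ = ln_norm_holomorphic_harmonic[OF \<Omega>(1) Qhol Qnz]
  have lnQ2: "Ck_on 2 \<Omega> (\<lambda>x. ln (cmod (Q x)))"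
    using lnQ(1)[of "Suc 0"] by (simp add: numeral_2_eq_2 del: Ck_on.simps)
  note g = regular_part_harmonic[OF \<Omega>(1) G \<gamma> y]
  define H where "H x = \<gamma> x y + (- 1 / (2 * pi)) *\<^sub>R ln (cmod (Q x))" for x
  have "H x = 0"
  proof (rule harmonic_eq_0_if_vanishing_at_boundary[OF \<Omega> _ _ _ x])
    show "Ck_on 2 \<Omega> H" unfolding H_def[abs_def] by (rule Ck_on_add_scaled[OF \<Omega>(1) g(1) lnQ2])
    show "laplacian H x = 0" if "x \<in> \<Omega>" for x
    proof -
      have "laplacian (\<lambda>x. ln (cmod (Q x))) x = 0" using lnQ(2)[OF _ that] by simp
      then show ?thesis
        unfolding H_def[abs_def] laplacian_add_scaled[OF \<Omega>(1) g(1) lnQ2 that] g(2)[OF that] by simp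
    qed
    fix e :: real assume e: "0 < e"
    obtain K1 where K1: "compact K1" "K1 \<subseteq> \<Omega>" "y \<in> K1" "\<And>x. x \<in> \<Omega> - K1 \<Longrightarrow> \<bar>G x y\<bar> < e / 2"
      using green_function_compact_exhaustion[OF \<Omega> G y, of "e / 2"] e by auto
    obtain K2 where K2: "compact K2" "K2 \<subseteq> ball 0 1"
      "\<And>z. z \<in> ball 0 1 - K2 \<Longrightarrow> \<bar>ln (cmod (Moebius_function 0 (T y) z))\<bar> < e / 2"
      using Moebius_compact_exhaustion[OF T1[OF y], of "e / 2"] e by auto
    let ?K = "K1 \<union> inv_into \<Omega> T ` K2"
    have "compact ?K"
      using K1(1) K2(1) holomorphic_on_imp_continuous_on[OF hol_inv]
      by (intro compact_Un compact_continuous_image continuous_on_subset[OF _ K2(2)])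
    moreover have "?K \<subseteq> \<Omega>"
      using K1(2) K2(2) inv_into_into[of _ T \<Omega>] unfolding img by auto
    moreover have "\<bar>H x\<bar> < e" if x: "x \<in> \<Omega> - ?K" for x
    proof -
      have xy: "x \<noteq> y" using x K1(3) by auto
      have xO: "x \<in> \<Omega>" using x by simp
      have "T x \<in> ball 0 1 - K2"
        using x T1[OF xO] inv_into_f_f[OF inj xO] by (auto intro: rev_image_eqI)
      from K2(3)[OF this]
      have M: "\<bar>ln (cmod (Moebius_function 0 (T y) (T x)))\<bar> < e / 2" .
      have Q: "Q x = Moebius_function 0 (T y) (T x) / (x - y)"
        using xy by (simp add: Q_def diff_quotient_def Moebius_function_simple)
      have "Moebius_function 0 (T y) (T x) \<noteq> 0" using Qnz[OF xO] Q by auto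
      then have "ln (cmod (Q x)) = ln (cmod (Moebius_function 0 (T y) (T x))) - ln (cmod (x - y))"
        using xy by (simp add: Q norm_divide ln_div)
      moreover have "\<gamma> x y = G x y - 1 / (2 * pi) * ln (cmod (x - y))"
        using \<gamma> xO y xy by (auto simp: regular_part_def)
      ultimately have "H x = G x y - 1 / (2 * pi) * ln (cmod (Moebius_function 0 (T y) (T x)))"
        by (simp add: H_def field_simps)
      moreover have "\<bar>1 / (2 * pi) * ln (cmod (Moebius_function 0 (T y) (T x)))\<bar> < e / 2"
      proof -
        have "1 / (2 * pi) \<le> 1" using pi_ge_two by simp
        then have "\<bar>1 / (2 * pi) * ln (cmod (Moebius_function 0 (T y) (T x)))\<bar>
            \<le> 1 * \<bar>ln (cmod (Moebius_function 0 (T y) (T x)))\<bar>"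
          unfolding abs_mult by (intro mult_right_mono) auto
        then show ?thesis using M by simp
      qed
      moreover have "\<bar>G x y\<bar> < e / 2" using K1(4)[of x] x by simp
      ultimately show ?thesis by linarith
    qed
    ultimately show "\<exists>K. compact K \<and> K \<subseteq> \<Omega> \<and> (\<forall>x\<in>\<Omega> - K. \<bar>H x\<bar> < e)" by blast
  qed
  then show ?thesis by (simp add: H_def Q_def)
qed

text \<open>On the diagonal the difference quotient is \<open>T' x\<close>, and \<open>1 - cnj (T x) * T x\<close> is real and
  positive.\<close>

corollary robin_eq:
  assumes "open \<Omega>" "bounded \<Omega>" "green_function \<Omega> G" "regular_part \<Omega> G \<gamma>"
    and T: "biholomorphism T \<Omega> (ball 0 1)" and x: "x \<in> \<Omega>"
  shows "robin \<gamma> x = (ln (cmod (deriv T x)) - ln (1 - (cmod (T x))\<^sup>2)) / (2 * pi)"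
proof -
  have T1: "cmod (T x) < 1" using T x by (auto simp: biholomorphism_def bij_betw_def)
  have "deriv T x \<noteq> 0"
    using T x assms(1) by (intro holomorphic_injective_imp_regular[of T \<Omega>])
      (auto simp: biholomorphism_def bij_betw_def)
  moreover have "cmod (1 - cnj (T x) * T x) = 1 - (cmod (T x))\<^sup>2"
  proof -
    have "1 - cnj (T x) * T x = of_real (1 - (cmod (T x))\<^sup>2)"
      by (simp only: complex_norm_square of_real_diff of_real_1 mult.commute)
    moreover have "(cmod (T x))\<^sup>2 \<le> 1" using T1 by (simp add: abs_square_le_1)
    ultimately show ?thesis by (simp only: norm_of_real)
  qed
  moreover have "0 < 1 - (cmod (T x))\<^sup>2" using T1 by (simp add: abs_square_less_1)
  ultimately show ?thesis
    unfolding robin_def regular_part_eq[OF assms x]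
    by (simp add: diff_quotient_def norm_divide ln_div)
qed

section \<open>The gradient of the Robin function\<close>

text \<open>This is \<open>2 \<pi>\<close> times the gradient of the Robin function (\<open>robin_has_derivative\<close>), with
  \<open>\<bar>T\<bar>\<^sup>2\<close> written as \<open>T * cnj T\<close> so that the holomorphic and antiholomorphic factors can be
  differentiated separately.\<close>

definition robin_field :: "(complex \<Rightarrow> complex) \<Rightarrow> complex \<Rightarrow> complex" where
  "robin_field T x = cnj (deriv (deriv T) x / deriv T x)
     + 2 * T x * cnj (deriv T x) / (1 - T x * cnj (T x))"

lemma biholomorphism_diskD:
  assumes "biholomorphism T \<Omega> (ball 0 1)" "open \<Omega>" "x \<in> \<Omega>"
  shows "cmod (T x) < 1" "deriv T x \<noteq> 0" "1 - T x * cnj (T x) \<noteq> 0"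
proof -
  show 1: "cmod (T x) < 1" using assms by (auto simp: biholomorphism_def bij_betw_def)
  show "deriv T x \<noteq> 0"
    using assms by (intro holomorphic_injective_imp_regular[of T \<Omega>])
      (auto simp: biholomorphism_def bij_betw_def)
  show "1 - T x * cnj (T x) \<noteq> 0"
    using one_minus_cnj_mult_neq_0[of "T x" "T x"] 1 by (simp add: mult.commute)
qed

lemma grad_eqI:
  assumes "(f has_derivative (\<lambda>h. v \<bullet> h)) (at x)"
  shows "grad f x = v"
proof -
  have "frechet_derivative f (at x) = (\<lambda>h. v \<bullet> h)" using frechet_derivative_at[OF assms] by simp
  then show ?thesis by (simp add: grad_def euclidean_representation)
qed

lemma robin_has_derivative:
  assumes \<Omega>: "open \<Omega>" "bounded \<Omega>" and G: "green_function \<Omega> G" and \<gamma>: "regular_part \<Omega> G \<gamma>"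
    and T: "biholomorphism T \<Omega> (ball 0 1)" and x: "x \<in> \<Omega>"
  shows "(robin \<gamma> has_derivative (\<lambda>h. (robin_field T x /\<^sub>R (2 * pi)) \<bullet> h)) (at x)"
proof -
  have hol: "T holomorphic_on \<Omega>" using T by (simp add: biholomorphism_def)
  note D = biholomorphism_diskD[OF T \<Omega>(1) x]
  define d where "d = 1 - (cmod (T x))\<^sup>2"
  have d: "0 < d" using D(1) by (simp add: d_def abs_square_less_1)
  have d': "1 - T x * cnj (T x) = of_real d"
    by (simp only: d_def complex_norm_square of_real_diff of_real_1)
  have T': "(T has_derivative (\<lambda>h. deriv T x * h)) (at x)"
    using holomorphic_derivI[OF hol \<Omega>(1) x] by (simp add: has_field_derivative_def)
  have 1: "((\<lambda>x. ln (cmod (deriv T x))) has_derivative (\<lambda>h. Re (deriv (deriv T) x / deriv T x * h))) (at x)"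
    by (rule has_derivative_ln_norm[OF holomorphic_derivI[OF holomorphic_deriv[OF hol \<Omega>(1)] \<Omega>(1) x] D(2)])
  have "((\<lambda>x. 1 - T x \<bullet> T x) has_derivative (\<lambda>h. 0 - (T x \<bullet> (deriv T x * h) + (deriv T x * h) \<bullet> T x))) (at x)"
    by (intro has_derivative_diff has_derivative_const has_derivative_inner T')
  then have "((\<lambda>x. 1 - (cmod (T x))\<^sup>2) has_derivative (\<lambda>h. - 2 * (T x \<bullet> (deriv T x * h)))) (at x)"
    by (simp add: power2_norm_eq_inner inner_commute)
  moreover have "(ln has_derivative (*) (1 / d)) (at (1 - (cmod (T x))\<^sup>2))"
    using DERIV_ln[OF d] unfolding d_def has_field_derivative_def by (simp add: inverse_eq_divide)
  ultimately have 2: "((\<lambda>x. ln (1 - (cmod (T x))\<^sup>2)) has_derivative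
      (\<lambda>h. 1 / d * (- 2 * (T x \<bullet> (deriv T x * h))))) (at x)"
    by (rule has_derivative_compose)
  have 3: "((\<lambda>x. (ln (cmod (deriv T x)) - ln (1 - (cmod (T x))\<^sup>2)) / (2 * pi)) has_derivative
      (\<lambda>h. (Re (deriv (deriv T) x / deriv T x * h) - 1 / d * (- 2 * (T x \<bullet> (deriv T x * h)))) / (2 * pi))) (at x)"
    using has_derivative_mult_left[OF has_derivative_diff[OF 1 2], of "inverse (2 * pi)"]
    by (simp only: divide_inverse)
  have eq: "(Re (q * h) - 1 / d * (- 2 * (t \<bullet> (t' * h)))) / (2 * pi)
      = ((cnj q + 2 * t * cnj t' / of_real d) /\<^sub>R (2 * pi)) \<bullet> h" for q t t' h
    using d by (simp add: inner_complex_def field_simps)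
  have "(robin \<gamma> has_derivative (\<lambda>h. (Re (deriv (deriv T) x / deriv T x * h)
      - 1 / d * (- 2 * (T x \<bullet> (deriv T x * h)))) / (2 * pi))) (at x)"
    by (rule has_derivative_transform_within_open[OF 3 \<Omega>(1) x])
      (rule robin_eq[OF \<Omega> G \<gamma> T, symmetric])
  then show ?thesis unfolding eq robin_field_def d' .
qed

lemma has_derivative_cnj_holomorphic:
  "(f has_field_derivative f') (at x) \<Longrightarrow> ((\<lambda>x. cnj (f x)) has_derivative (\<lambda>h. cnj f' * cnj h)) (at x)"
  unfolding has_field_derivative_def by (drule has_derivative_cnj) simp

text \<open>\<open>P\<close> and \<open>N\<close> are the two Wirtinger derivatives. Their continuity yields local Lipschitz bounds
  for the velocity field, and their values where \<open>T\<close> and its second derivative vanish give the linearization at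
  the stationary point.\<close>

lemma robin_field_has_derivative:
  assumes \<Omega>: "open \<Omega>" and T: "biholomorphism T \<Omega> (ball 0 1)"
  obtains P N where "\<And>x. x \<in> \<Omega> \<Longrightarrow> (robin_field T has_derivative (\<lambda>h. P x * h + N x * cnj h)) (at x)"
    "continuous_on \<Omega> P" "continuous_on \<Omega> N"
    "\<And>x. x \<in> \<Omega> \<Longrightarrow> T x = 0 \<Longrightarrow> (deriv ^^ 2) T x = 0 \<Longrightarrow>
       P x = of_real (2 * (cmod (deriv T x))\<^sup>2) \<and> N x = cnj ((deriv ^^ 3) T x / deriv T x)"
proof
  define T1 T2 T3 where "T1 = deriv T" and "T2 = deriv T1" and "T3 = deriv T2"
  define D where "D x = 1 - T x * cnj (T x)" for x
  have h0: "T holomorphic_on \<Omega>" using T by (simp add: biholomorphism_def)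
  have h1: "T1 holomorphic_on \<Omega>" unfolding T1_def by (rule holomorphic_deriv[OF h0 \<Omega>])
  have h2: "T2 holomorphic_on \<Omega>" unfolding T2_def by (rule holomorphic_deriv[OF h1 \<Omega>])
  have h3: "T3 holomorphic_on \<Omega>" unfolding T3_def by (rule holomorphic_deriv[OF h2 \<Omega>])
  have nz: "T1 x \<noteq> 0" "D x \<noteq> 0" if "x \<in> \<Omega>" for x
    using biholomorphism_diskD[OF T \<Omega> that] by (auto simp: T1_def D_def)
  define q' where "q' x = (T3 x * T1 x - T2 x * T2 x) / (T1 x * T1 x)" for x
  define P where "P x = 2 * T1 x * cnj (T1 x) / D x + 2 * T x * cnj (T1 x) * (T1 x * cnj (T x)) / (D x * D x)" for x
  define N where "N x = cnj (q' x) + 2 * T x * cnj (T2 x) / D x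
    + 2 * T x * cnj (T1 x) * (T x * cnj (T1 x)) / (D x * D x)" for x
  show "(robin_field T has_derivative (\<lambda>h. P x * h + N x * cnj h)) (at x)" if x: "x \<in> \<Omega>" for x
  proof -
    have d0: "(T has_field_derivative T1 x) (at x)" and d1: "(T1 has_field_derivative T2 x) (at x)"
      and d2: "(T2 has_field_derivative T3 x) (at x)"
      unfolding T1_def T2_def T3_def
      by (rule holomorphic_derivI[OF _ \<Omega> x]; use h0 h1 h2 in \<open>simp add: T1_def T2_def\<close>)+
    have dq: "((\<lambda>x. T2 x / T1 x) has_field_derivative q' x) (at x)"
      unfolding q'_def using DERIV_divide[OF d2 d1] nz(1)[OF x] by simp
    note c = has_derivative_cnj_holomorphic[OF d0] has_derivative_cnj_holomorphic[OF d1]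
      has_derivative_cnj_holomorphic[OF dq]
    have d0': "(T has_derivative (\<lambda>h. T1 x * h)) (at x)" using d0 by (simp add: has_field_derivative_def)
    have dD: "(D has_derivative (\<lambda>h. 0 - (T x * (cnj (T1 x) * cnj h) + T1 x * h * cnj (T x)))) (at x)"
      unfolding D_def by (intro has_derivative_diff has_derivative_const has_derivative_mult d0' c)
    have dA: "((\<lambda>x. 2 * T x * cnj (T1 x)) has_derivative
        (\<lambda>h. 2 * T x * (cnj (T2 x) * cnj h) + 2 * (T1 x * h) * cnj (T1 x))) (at x)"
      by (intro has_derivative_mult has_derivative_mult_right d0' c)
    have "((\<lambda>x. cnj (T2 x / T1 x) + 2 * T x * cnj (T1 x) / D x) has_derivative
        (\<lambda>h. cnj (q' x) * cnj h + ((2 * T x * (cnj (T2 x) * cnj h) + 2 * (T1 x * h) * cnj (T1 x)) * D x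
          - 2 * T x * cnj (T1 x) * (0 - (T x * (cnj (T1 x) * cnj h) + T1 x * h * cnj (T x)))) / (D x * D x))) (at x)"
      by (intro has_derivative_add c has_derivative_divide' dA dD nz x)
    moreover have "robin_field T = (\<lambda>x. cnj (T2 x / T1 x) + 2 * T x * cnj (T1 x) / D x)"
      by (simp add: robin_field_def[abs_def] D_def[abs_def] T1_def T2_def)
    moreover have "cnj (q' x) * cnj h + ((2 * T x * (cnj (T2 x) * cnj h) + 2 * (T1 x * h) * cnj (T1 x)) * D x
          - 2 * T x * cnj (T1 x) * (0 - (T x * (cnj (T1 x) * cnj h) + T1 x * h * cnj (T x)))) / (D x * D x)
          = P x * h + N x * cnj h" for h
      unfolding P_def N_def using nz(2)[OF x] by (simp add: field_simps)
    ultimately show ?thesis by simp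
  qed
  note c = holomorphic_on_imp_continuous_on
  show "continuous_on \<Omega> P"
    unfolding P_def[abs_def] D_def
    by (intro continuous_intros c h0 h1 h2 h3) (use nz in \<open>auto simp: D_def\<close>)
  show "continuous_on \<Omega> N"
    unfolding N_def[abs_def] D_def q'_def
    by (intro continuous_intros c h0 h1 h2 h3) (use nz in \<open>auto simp: D_def\<close>)
  show "P x = of_real (2 * (cmod (deriv T x))\<^sup>2) \<and> N x = cnj ((deriv ^^ 3) T x / deriv T x)"
    if x: "x \<in> \<Omega>" and "T x = 0" "(deriv ^^ 2) T x = 0" for x
  proof -
    have "T2 x = 0" using that(3) by (simp add: T2_def T1_def numeral_2_eq_2)
    moreover have "(deriv ^^ 3) T x = T3 x" by (simp add: T3_def T2_def T1_def numeral_3_eq_3)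
    ultimately show ?thesis
      using that(2) nz(1)[OF x] complex_norm_square[of "T1 x"]
      by (simp add: P_def N_def D_def q'_def T1_def[symmetric] mult.assoc)
  qed
qed

section \<open>Compactness of the sublevel sets of the Robin function\<close>

text \<open>The quotient is the conformal radius of the domain at \<open>z n\<close>. If it stayed above \<open>c\<close> along a
  sequence that approaches the boundary, then by Bloch's theorem the inverse of \<open>T\<close> would map the disks
  of radius \<open>1 - \<bar>T (z n)\<bar>\<close> around \<open>T (z n)\<close> onto sets that contain disks of the fixed radius
  \<open>c / 24\<close>. The centres of these disks accumulate at some point \<open>l\<close> by boundedness of the domain, so that
  infinitely many of the sets contain \<open>l\<close>. By injectivity \<open>T l\<close> then lies in infinitely many of the shrinking
  disks, which forces \<open>\<bar>T l\<bar> = 1\<close>.\<close>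

lemma no_boundary_sequence_with_large_conformal_radius:
  fixes z :: "nat \<Rightarrow> complex"
  assumes \<Omega>: "open \<Omega>" "bounded \<Omega>" and T: "biholomorphism T \<Omega> (ball 0 1)"
    and z: "\<And>n. z n \<in> \<Omega>" and lim: "(\<lambda>n. cmod (T (z n))) \<longlonglongrightarrow> 1"
    and lower: "\<And>n. c \<le> (1 - (cmod (T (z n)))\<^sup>2) / cmod (deriv T (z n))" and c: "0 < c"
  shows False
proof -
  define S where "S = inv_into \<Omega> T"
  have hol: "T holomorphic_on \<Omega>" and inj: "inj_on T \<Omega>" and img: "T ` \<Omega> = ball 0 1"
    and holS: "S holomorphic_on ball 0 1"
    using T by (auto simp: biholomorphism_def bij_betw_def S_def)
  have ST: "S (T x) = x" if "x \<in> \<Omega>" for x using inv_into_f_f[OF inj that] by (simp add: S_def)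
  have S\<Omega>: "S w \<in> \<Omega>" "T (S w) = w" if "w \<in> ball 0 1" for w
    using that inv_into_into[of w T \<Omega>] f_inv_into_f[of w T \<Omega>] unfolding img by (auto simp: S_def)
  define w where "w n = T (z n)" for n
  have w: "w n \<in> ball 0 1" for n using z[of n] img by (auto simp: w_def)
  define r where "r n = 1 - cmod (w n)" for n
  have r: "0 < r n" for n using w[of n] by (simp add: r_def)
  have sub: "ball (w n) (r n) \<subseteq> ball 0 1" for n
    by (auto simp: r_def dist_norm) (metis add.commute diff_add_cancel less_diff_eq norm_minus_commute norm_triangle_ineq order_le_less_trans)
  have S': "deriv S (w n) = inverse (deriv T (z n))" for n
  proof -
    have "((\<lambda>x. S (T x)) has_field_derivative deriv S (T (z n)) * deriv T (z n)) (at (z n))"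
      by (rule DERIV_chain2[OF holomorphic_derivI[OF holS open_ball] holomorphic_derivI[OF hol \<Omega>(1) z]])
        (use w[of n] in \<open>simp add: w_def\<close>)
    then have "((\<lambda>x. x) has_field_derivative deriv S (T (z n)) * deriv T (z n)) (at (z n))"
      by (rule has_field_derivative_transform_within_open[OF _ \<Omega>(1) z]) (rule ST)
    then have "deriv S (T (z n)) * deriv T (z n) = 1" using DERIV_unique DERIV_ident by blast
    then show ?thesis using biholomorphism_diskD(2)[OF T \<Omega>(1) z] by (simp add: w_def field_simps)
  qed
  \<comment> \<open>Bloch constant 1/12, and \<open>1 - \<bar>w\<bar>\<^sup>2 \<le> 2 (1 - \<bar>w\<bar>)\<close>.\<close>
  have big: "c / 24 \<le> r n * cmod (deriv S (w n)) / 12" for n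
  proof -
    have "c \<le> (1 - (cmod (w n))\<^sup>2) * cmod (deriv S (w n))"
      using lower[of n] unfolding S' by (simp add: norm_inverse divide_inverse w_def)
    also have "1 - (cmod (w n))\<^sup>2 \<le> 2 * r n"
      using zero_le_power2[of "1 - cmod (w n)"] unfolding r_def power2_diff by simp
    then have "(1 - (cmod (w n))\<^sup>2) * cmod (deriv S (w n)) \<le> 2 * r n * cmod (deriv S (w n))"
      by (rule mult_right_mono) simp
    finally show ?thesis by simp
  qed
  have "\<exists>b. ball b (c / 24) \<subseteq> S ` ball (w n) (r n)" for n
    using Bloch[OF holomorphic_on_subset[OF holS sub] r big] by blast
  then obtain b where b: "\<And>n. ball (b n) (c / 24) \<subseteq> S ` ball (w n) (r n)" by metis
  have "b n \<in> \<Omega>" for n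
  proof -
    have "b n \<in> S ` ball (w n) (r n)" using b[of n] c by auto
    then show ?thesis using sub[of n] S\<Omega>(1) by auto
  qed
  then have "bounded (range b)" using \<Omega>(2) by (auto intro: bounded_subset)
  then obtain l s where s: "strict_mono (s :: nat \<Rightarrow> nat)" and l: "(b \<circ> s) \<longlonglongrightarrow> l"
    using bounded_imp_convergent_subsequence by blast
  have "\<forall>\<^sub>F n in sequentially. dist ((b \<circ> s) n) l < c / 24"
    using tendstoD[OF l, of "c / 24"] c by simp
  then have ev: "\<forall>\<^sub>F n in sequentially. l \<in> \<Omega> \<and> 2 * cmod (w (s n)) - 1 \<le> cmod (T l)"
  proof eventually_elim
    case (elim n)
    then have "l \<in> S ` ball (w (s n)) (r (s n))" using b[of "s n"] by auto
    then obtain v where v: "v \<in> ball (w (s n)) (r (s n))" "l = S v" by blast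
    have v1: "v \<in> ball 0 1" using sub[of "s n"] v(1) by blast
    have "cmod (w (s n)) - cmod v \<le> dist (w (s n)) v"
      unfolding dist_norm by (rule norm_triangle_ineq2)
    then show ?case using v S\<Omega>[OF v1] by (auto simp: r_def)
  qed
  have "(\<lambda>n. 2 * cmod (w (s n)) - 1) \<longlonglongrightarrow> 2 * 1 - 1"
    using LIMSEQ_subseq_LIMSEQ[OF lim s] unfolding w_def o_def by (intro tendsto_intros)
  then have "2 * 1 - 1 \<le> cmod (T l)"
    by (rule tendsto_upperbound[OF _ eventually_mono[OF ev]]) auto
  moreover have "l \<in> \<Omega>" using eventually_happens[OF ev] by auto
  then have "cmod (T l) < 1" using img by auto
  ultimately show False by simp
qed

text \<open>An upper bound on the Robin function is a lower bound on the conformal radius, which a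
  sequence that leaves every compact subset of the domain cannot satisfy.\<close>

lemma robin_sublevel_compact:
  assumes \<Omega>: "open \<Omega>" "bounded \<Omega>" and G: "green_function \<Omega> G" and \<gamma>: "regular_part \<Omega> G \<gamma>"
    and T: "biholomorphism T \<Omega> (ball 0 1)"
  shows "compact {x \<in> \<Omega>. robin \<gamma> x \<le> c}" (is "compact ?K")
proof -
  have inj: "inj_on T \<Omega>" and img: "T ` \<Omega> = ball 0 1"
    and holS: "inv_into \<Omega> T holomorphic_on ball 0 1"
    using T by (auto simp: biholomorphism_def bij_betw_def)
  have "closed ?K"
    unfolding closed_sequential_limits
  proof (intro allI impI, elim conjE)
    fix z l assume z: "\<forall>n. z n \<in> ?K" and l: "z \<longlonglongrightarrow> l"
    have "l \<in> \<Omega>"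
    proof (rule ccontr)
      assume nl: "l \<notin> \<Omega>"
      have "(\<lambda>n. cmod (T (z n))) \<longlonglongrightarrow> 1"
      proof (rule tendstoI)
        fix e :: real assume e: "0 < e"
        let ?C = "inv_into \<Omega> T ` cball 0 (1 - e)"
        have sub: "cball (0::complex) (1 - e) \<subseteq> ball 0 1" using e by auto
        have "compact ?C"
          by (intro compact_continuous_image compact_cball
              continuous_on_subset[OF holomorphic_on_imp_continuous_on[OF holS] sub])
        then have "open (- ?C)" by (simp add: compact_imp_closed open_Compl)
        moreover have "l \<in> - ?C"
          using nl sub inv_into_into[of _ T \<Omega>] unfolding img by blast
        ultimately have "\<forall>\<^sub>F n in sequentially. z n \<in> - ?C" using l by (rule topological_tendstoD[rotated])
        then show "\<forall>\<^sub>F n in sequentially. dist (cmod (T (z n))) 1 < e"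
        proof eventually_elim
          case (elim n)
          have zn: "z n \<in> \<Omega>" using z by auto
          have "T (z n) \<notin> cball 0 (1 - e)"
            using elim inv_into_f_f[OF inj zn] by (metis ComplD image_eqI)
          then show ?case using biholomorphism_diskD(1)[OF T \<Omega>(1) zn] by (simp add: dist_real_def)
        qed
      qed
      moreover have "exp (- (2 * pi * c)) \<le> (1 - (cmod (T (z n)))\<^sup>2) / cmod (deriv T (z n))" for n
      proof -
        have zn: "z n \<in> \<Omega>" "robin \<gamma> (z n) \<le> c" using z by auto
        note D = biholomorphism_diskD[OF T \<Omega>(1) zn(1)]
        have p: "0 < 1 - (cmod (T (z n)))\<^sup>2" "0 < cmod (deriv T (z n))"
          using D by (auto simp: abs_square_less_1)
        have "- (2 * pi * c) \<le> ln (1 - (cmod (T (z n)))\<^sup>2) - ln (cmod (deriv T (z n)))"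
          using zn(2) unfolding robin_eq[OF \<Omega> G \<gamma> T zn(1)] by (simp add: field_simps)
        also have "\<dots> = ln ((1 - (cmod (T (z n)))\<^sup>2) / cmod (deriv T (z n)))"
          using p by (simp add: ln_div)
        finally have "exp (- (2 * pi * c)) \<le> exp (ln ((1 - (cmod (T (z n)))\<^sup>2) / cmod (deriv T (z n))))"
          by simp
        moreover have "0 < (1 - (cmod (T (z n)))\<^sup>2) / cmod (deriv T (z n))" using p by (rule divide_pos_pos)
        ultimately show ?thesis by (simp only: exp_ln)
      qed
      ultimately show False
        using no_boundary_sequence_with_large_conformal_radius[OF \<Omega> T, of z "exp (- (2 * pi * c))"] z by auto
    qed
    moreover have "robin \<gamma> l \<le> c"
    proof -
      have "isCont (robin \<gamma>) l"
        using has_derivative_continuous[OF robin_has_derivative[OF \<Omega> G \<gamma> T \<open>l \<in> \<Omega>\<close>]] .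
      then have "(\<lambda>n. robin \<gamma> (z n)) \<longlonglongrightarrow> robin \<gamma> l" using l by (rule isCont_tendsto_compose)
      then show ?thesis by (rule LIMSEQ_le_const2) (use z in auto)
    qed
    ultimately show "l \<in> ?K" by simp
  qed
  moreover have "bounded ?K" using \<Omega>(2) by (rule bounded_subset) auto
  ultimately show ?thesis by (simp add: compact_eq_bounded_closed)
qed

section \<open>Global solutions of ordinary differential equations\<close>

lemma integral_has_vector_derivative_atLeast:
  fixes f :: "real \<Rightarrow> 'a::banach"
  assumes "continuous_on {0..} f" "0 \<le> t"
  shows "((\<lambda>t. integral {0..t} f) has_vector_derivative f t) (at t within {0..})"
proof -
  have "((\<lambda>t. integral {0..t} f) has_vector_derivative f t) (at t within {0..t + 1})"
    by (rule integral_has_vector_derivative[OF continuous_on_subset[OF assms(1)]]) (use assms(2) in auto)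
  moreover have "at t within {0..t + 1} = at t within {0..}"
    by (rule at_within_nhd[of _ "{..<t + 1}"]) auto
  ultimately show ?thesis by simp
qed

text \<open>The unknown is \<open>u t = exp (- k t) *\<^sub>R z t\<close>, a bounded continuous function. For \<open>k > 2 L\<close>
  the integral equation is a contraction with constant 1/2 in the supremum norm on the whole time
  axis, so that a single fixed point gives the solution for all times. Negative times are
  mapped to 0, which keeps the unknown a function on the real line.\<close>

theorem lipschitz_ode_global_solution:
  fixes V :: "'a::banach \<Rightarrow> 'a"
  assumes V: "L-lipschitz_on UNIV V" and bdd: "bounded (range V)"
  obtains z where "z 0 = z0" "\<And>t. 0 \<le> t \<Longrightarrow> (z has_vector_derivative V (z t)) (at t within {0..})"
proof -
  have L: "0 \<le> L" using lipschitz_on_nonneg[OF V] .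
  have cV: "continuous_on UNIV V" using lipschitz_on_continuous_on[OF V] .
  obtain M where M: "\<And>x. norm (V x) \<le> M" using bdd by (auto simp: bounded_iff)
  have M0: "0 \<le> M" using M[of 0] norm_ge_zero order_trans by blast
  define k where "k = 2 * L + 1"
  have k: "0 < k" using L by (simp add: k_def)
  define f where "f u s = V (exp (k * s) *\<^sub>R u s)" for u :: "real \<Rightarrow> 'a" and s
  define I where "I u t = exp (- k * t) *\<^sub>R (z0 + integral {0..t} (f u))" for u t
  define \<Phi> where "\<Phi> u t = I u (max 0 t)" for u t
  have cf: "continuous_on UNIV (f u)" if "continuous_on UNIV u" for u
    unfolding f_def by (intro continuous_intros continuous_on_compose2[OF cV] that) auto
  have fi: "f u integrable_on {0..t}" if "continuous_on UNIV u" for u t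
    by (intro integrable_continuous_real continuous_on_subset[OF cf[OF that]]) auto
  have der: "((\<lambda>t. integral {0..t} (f u)) has_vector_derivative f u t) (at t within {0..})"
    if "continuous_on UNIV u" "0 \<le> t" for u t
    by (intro integral_has_vector_derivative_atLeast continuous_on_subset[OF cf[OF that(1)]] that(2)) auto
  have bcont: "\<Phi> u \<in> bcontfun" if u: "continuous_on UNIV u" for u
  proof -
    have "continuous_on {0..} (\<lambda>t. integral {0..t} (f u))"
      unfolding continuous_on_eq_continuous_within
      using der[OF u] has_vector_derivative_continuous by fastforce
    then have "continuous_on {0..} (I u)" unfolding I_def by (intro continuous_intros)
    then have "continuous_on UNIV (\<Phi> u)"
      unfolding \<Phi>_def by (rule continuous_on_compose2) (auto intro!: continuous_intros)
    moreover have "norm (\<Phi> u t) \<le> norm z0 + M / k" for t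
    proof -
      define \<tau> where "\<tau> = max 0 t"
      have \<tau>: "0 \<le> \<tau>" by (simp add: \<tau>_def)
      have "norm (integral {0..\<tau>} (f u)) \<le> integral {0..\<tau>} (\<lambda>_. M)"
        by (intro integral_norm_bound_integral fi u) (auto simp: f_def M)
      also have "\<dots> = M * \<tau>" using \<tau> by simp
      finally have "norm (z0 + integral {0..\<tau>} (f u)) \<le> norm z0 + M * \<tau>"
        using norm_triangle_ineq order_trans by (metis add_left_mono)
      then have "norm (\<Phi> u t) \<le> exp (- k * \<tau>) * (norm z0 + M * \<tau>)"
        unfolding \<Phi>_def I_def \<tau>_def[symmetric] by simp
      also have "\<dots> = exp (- k * \<tau>) * norm z0 + M / k * (exp (- k * \<tau>) * (k * \<tau>))"
        using k by (simp add: field_simps)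
      also have "\<dots> \<le> 1 * norm z0 + M / k * 1"
      proof (intro add_mono mult_right_mono mult_left_mono)
        show "exp (- k * \<tau>) \<le> 1" using k \<tau> by simp
        have "k * \<tau> \<le> exp (k * \<tau>)" using exp_ge_add_one_self[of "k * \<tau>"] by linarith
        then show "exp (- k * \<tau>) * (k * \<tau>) \<le> 1" by (simp add: exp_minus field_simps)
      qed (use M0 k in auto)
      finally show ?thesis by simp
    qed
    ultimately show ?thesis by (auto simp: bcontfun_def bounded_iff)
  qed
  define \<Psi> where "\<Psi> u = Bcontfun (\<Phi> (apply_bcontfun u))" for u :: "real \<Rightarrow>\<^sub>C 'a"
  have \<Psi>: "apply_bcontfun (\<Psi> u) = \<Phi> (apply_bcontfun u)" for u
    unfolding \<Psi>_def by (rule Bcontfun_inverse[OF bcont]) simp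
  have contr: "dist (\<Psi> u) (\<Psi> v) \<le> 1 / 2 * dist u v" for u v
  proof (rule dist_bound)
    fix t :: real
    define \<tau> where "\<tau> = max 0 t"
    have \<tau>: "0 \<le> \<tau>" by (simp add: \<tau>_def)
    define d where "d = dist u v"
    have d0: "0 \<le> d" by (simp add: d_def)
    have d: "norm (u s - v s) \<le> d" for s using dist_bounded[of u s v] by (simp add: d_def dist_norm)
    have hi: "((\<lambda>s. L * d * exp (k * s)) has_integral (L * d / k * exp (k * \<tau>) - L * d / k * exp (k * 0))) {0..\<tau>}"
      by (rule fundamental_theorem_of_calculus[OF \<tau>])
        (use k in \<open>auto intro!: derivative_eq_intros simp: has_real_derivative_iff_has_vector_derivative[symmetric]\<close>)
    have "norm (integral {0..\<tau>} (\<lambda>s. f u s - f v s)) \<le> integral {0..\<tau>} (\<lambda>s. L * d * exp (k * s))"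
    proof (rule integral_norm_bound_integral)
      show "(\<lambda>s. f u s - f v s) integrable_on {0..\<tau>}" by (intro integrable_diff fi) auto
      show "(\<lambda>s. L * d * exp (k * s)) integrable_on {0..\<tau>}" using hi by blast
      fix s
      have "norm (f u s - f v s) \<le> L * dist (exp (k * s) *\<^sub>R u s) (exp (k * s) *\<^sub>R v s)"
        using lipschitz_onD[OF V, of "exp (k * s) *\<^sub>R u s" "exp (k * s) *\<^sub>R v s"] by (simp add: f_def dist_norm)
      also have "\<dots> = L * (exp (k * s) * norm (u s - v s))"
        by (simp add: dist_norm scaleR_diff_right[symmetric])
      also have "\<dots> \<le> L * (exp (k * s) * d)" using L d by (intro mult_left_mono) auto
      finally show "norm (f u s - f v s) \<le> L * d * exp (k * s)" by (simp add: mult_ac)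
    qed
    also have "\<dots> = L * d / k * exp (k * \<tau>) - L * d / k" 
      by (simp only: integral_unique[OF hi] mult_zero_right exp_zero mult_1_right)
    also have "\<dots> \<le> L * d / k * exp (k * \<tau>)" using L k d0 by simp
    finally have *: "norm (integral {0..\<tau>} (\<lambda>s. f u s - f v s)) \<le> L * d / k * exp (k * \<tau>)" .
    have "dist (\<Psi> u t) (\<Psi> v t) = exp (- k * \<tau>) * norm (integral {0..\<tau>} (f u) - integral {0..\<tau>} (f v))"
      unfolding \<Psi> \<Phi>_def I_def \<tau>_def[symmetric] dist_norm scaleR_diff_right[symmetric] by simp
    also have "integral {0..\<tau>} (f u) - integral {0..\<tau>} (f v) = integral {0..\<tau>} (\<lambda>s. f u s - f v s)"
      by (rule integral_diff[symmetric]; rule fi; simp)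
    also have "exp (- k * \<tau>) * norm (integral {0..\<tau>} (\<lambda>s. f u s - f v s)) \<le> exp (- k * \<tau>) * (L * d / k * exp (k * \<tau>))"
      by (rule mult_left_mono[OF *]) simp
    also have "\<dots> = L / k * d" by (simp add: exp_minus field_simps)
    also have "\<dots> \<le> 1 / 2 * d"
      using L k d0 by (intro mult_right_mono) (auto simp: k_def field_simps)
    finally show "dist (\<Psi> u t) (\<Psi> v t) \<le> 1 / 2 * dist u v" by (simp add: d_def)
  qed
  obtain u where u: "\<Psi> u = u" using banach_fix_type[of "1 / 2" \<Psi>] contr by auto
  have cu: "continuous_on UNIV (apply_bcontfun u)" by simp
  define z where "z t = z0 + integral {0..t} (f u)" for t
  have zu: "z t = exp (k * t) *\<^sub>R u t" if "0 \<le> t" for t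
  proof -
    have "u t = exp (- k * t) *\<^sub>R z t" using fun_cong[OF \<Psi>[of u], of t] that by (simp add: u \<Phi>_def I_def z_def)
    then show ?thesis by (simp add: exp_minus)
  qed
  show thesis
  proof (rule that)
    show "z 0 = z0" by (simp add: z_def)
    fix t :: real assume t: "0 \<le> t"
    have "(z has_vector_derivative 0 + f u t) (at t within {0..})"
      unfolding z_def by (intro has_vector_derivative_add has_vector_derivative_const der cu t)
    then show "(z has_vector_derivative V (z t)) (at t within {0..})" using zu[OF t] by (simp add: f_def)
  qed
qed

text \<open>Stated on a convex set of times, since it is used both on the half-line and on short
  intervals on which a trajectory is known to stay in the domain of \<open>R\<close>.\<close>

lemma conserved_along_solution:
  assumes S: "convex S" and z: "\<And>t. t \<in> S \<Longrightarrow> (z has_vector_derivative V (z t)) (at t within S)"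
    and R: "\<And>t. t \<in> S \<Longrightarrow> (R has_derivative D (z t)) (at (z t))"
    and 0: "\<And>t. t \<in> S \<Longrightarrow> D (z t) (V (z t)) = 0" and st: "s \<in> S" "t \<in> S"
  shows "R (z s) = R (z t)"
proof -
  have "((\<lambda>t. R (z t)) has_derivative (\<lambda>h. 0)) (at t within S)" if t: "t \<in> S" for t
  proof -
    have "((\<lambda>t. R (z t)) has_derivative (\<lambda>h. D (z t) (h *\<^sub>R V (z t)))) (at t within S)"
      by (rule has_derivative_compose[OF z[OF t, unfolded has_vector_derivative_def] R[OF t]])
    then show ?thesis
      using linear_scale[OF has_derivative_linear[OF R[OF t]]] 0[OF t] by simp
  qed
  from has_derivative_zero_constant[OF S this] obtain c where "\<forall>x\<in>S. R (z x) = c" by blast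
  then show ?thesis using st by simp
qed

text \<open>A compact set need not be convex, so the mean value inequality is applied on small disks
  only, and the local Lipschitz bounds are then combined by compactness.\<close>

lemma lipschitz_on_compact_if_C1:
  fixes V :: "complex \<Rightarrow> complex"
  assumes \<Omega>: "open \<Omega>" and V: "\<And>x. x \<in> \<Omega> \<Longrightarrow> (V has_derivative (\<lambda>h. P x * h + N x * cnj h)) (at x)"
    and c: "continuous_on \<Omega> P" "continuous_on \<Omega> N" and K: "compact K" "K \<subseteq> \<Omega>"
  obtains L where "L-lipschitz_on K V"
proof -
  have "local_lipschitz {0::real} \<Omega> (\<lambda>_. V)"
  proof (rule local_lipschitzI)
    fix t x assume "x \<in> \<Omega>"
    then obtain u where u: "0 < u" "cball x u \<subseteq> \<Omega>" using \<Omega> open_contains_cball by blast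
    have "continuous_on (cball x u) (\<lambda>y. cmod (P y) + cmod (N y))"
      using u(2) by (intro continuous_intros continuous_on_subset[OF c(1)] continuous_on_subset[OF c(2)])
    then have "bounded ((\<lambda>y. cmod (P y) + cmod (N y)) ` cball x u)"
      by (intro compact_imp_bounded compact_continuous_image compact_cball)
    then obtain B where "\<forall>y\<in>cball x u. norm (cmod (P y) + cmod (N y)) \<le> B"
      unfolding bounded_iff by blast
    then have B: "cmod (P y) + cmod (N y) \<le> B" if "y \<in> cball x u" for y using that by force
    have "x \<in> cball x u" using u(1) by simp
    from B[OF this] have "0 \<le> B" using norm_ge_zero[of "P x"] norm_ge_zero[of "N x"] by linarith
    have "onorm (\<lambda>h. P y * h + N y * cnj h) \<le> B" if y: "y \<in> cball x u" for y
    proof (rule onorm_le)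
      fix h
      have "cmod (P y * h + N y * cnj h) \<le> cmod (P y) * cmod h + cmod (N y) * cmod h"
        using norm_triangle_ineq[of "P y * h" "N y * cnj h"] by (simp add: norm_mult)
      also have "\<dots> \<le> B * cmod h"
        unfolding distrib_right[symmetric] by (rule mult_right_mono[OF B[OF y]]) simp
      finally show "cmod (P y * h + N y * cnj h) \<le> B * cmod h" .
    qed
    note onorm = this
    have "cmod (V v - V w) \<le> B * cmod (v - w)" if "v \<in> cball x u" "w \<in> cball x u" for v w
    proof (rule differentiable_bound[OF convex_cball _ onorm that])
      fix y assume "y \<in> cball x u"
      then have "y \<in> \<Omega>" using u(2) by blast
      then show "(V has_derivative (\<lambda>h. P y * h + N y * cnj h)) (at y within cball x u)"
        by (rule has_derivative_at_withinI[OF V])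
    qed
    then have "B-lipschitz_on (cball x u) V"
      using \<open>0 \<le> B\<close> unfolding lipschitz_on_def dist_norm by blast
    then have "B-lipschitz_on (cball x u \<inter> \<Omega>) V" by (rule lipschitz_on_subset) simp
    then show "\<exists>u>0. \<exists>L. \<forall>t\<in>cball t u \<inter> {0}. L-lipschitz_on (cball x u \<inter> \<Omega>) V"
      using u(1) by (intro exI[of _ u] exI[of _ B] conjI ballI)
  qed
  then have "local_lipschitz {0::real} K (\<lambda>_. V)" by (rule local_lipschitz_subset) (use K in auto)
  from local_lipschitz_compact_implies_lipschitz[OF this K(1)] show thesis using that by auto
qed

text \<open>The factor \<open>\<rho>\<close> is 1 on \<open>K\<close> and decreases linearly with the distance to \<open>K\<close>. Where
  it is not 0 the field is bounded and Lipschitz, by compactness.\<close>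

lemma lipschitz_cutoff:
  fixes V :: "complex \<Rightarrow> complex"
  assumes \<Omega>: "open \<Omega>" and K: "compact K" "K \<subseteq> \<Omega>" "K \<noteq> {}"
    and V: "\<And>N. compact N \<Longrightarrow> N \<subseteq> \<Omega> \<Longrightarrow> \<exists>L. L-lipschitz_on N V"
  obtains \<rho> L where "L-lipschitz_on UNIV (\<lambda>x. \<rho> x *\<^sub>R V x)" "bounded (range (\<lambda>x. \<rho> x *\<^sub>R V x))"
    "\<And>x. x \<in> K \<Longrightarrow> \<rho> x = (1::real)"
proof -
  obtain \<delta> where \<delta>: "0 < \<delta>" "{x. infdist x K \<le> \<delta>} \<subseteq> \<Omega>"
    using compact_in_open_separated[OF K(3,1) \<Omega> K(2)] by blast
  define N where "N = {x. infdist x K \<le> \<delta>}"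
  have N: "compact N" "N \<subseteq> \<Omega>"
    using \<delta> compact_infdist_le[OF K(3,1) \<delta>(1)] by (auto simp: N_def)
  obtain L where L: "L-lipschitz_on N V" using V[OF N] by blast
  have L0: "0 \<le> L" using lipschitz_on_nonneg[OF L] .
  have "bounded (V ` N)"
    by (intro compact_imp_bounded compact_continuous_image lipschitz_on_continuous_on[OF L] N)
  then obtain M0 where M0: "\<And>x. x \<in> N \<Longrightarrow> cmod (V x) \<le> M0" by (auto simp: bounded_iff)
  define M where "M = max M0 0"
  have M: "\<And>x. x \<in> N \<Longrightarrow> cmod (V x) \<le> M" "0 \<le> M" using M0 by (fastforce simp: M_def)+
  define \<rho> where "\<rho> x = max 0 (1 - infdist x K / \<delta>)" for x
  have \<rho>: "0 \<le> \<rho> x" "\<rho> x \<le> 1" for x using \<delta>(1) infdist_nonneg[of x K] by (auto simp: \<rho>_def)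
  have \<rho>0: "\<rho> x = 0" if "x \<notin> N" for x using that \<delta>(1) by (auto simp: \<rho>_def N_def field_simps)
  have \<rho>L: "\<bar>\<rho> x - \<rho> y\<bar> \<le> dist x y / \<delta>" for x y
  proof -
    have "\<bar>\<rho> x - \<rho> y\<bar> \<le> \<bar>infdist x K / \<delta> - infdist y K / \<delta>\<bar>" unfolding \<rho>_def by linarith
    also have "\<dots> = \<bar>infdist x K - infdist y K\<bar> / \<delta>" using \<delta>(1) by (simp add: diff_divide_distrib[symmetric])
    also have "\<dots> \<le> dist x y / \<delta>" using \<delta>(1) infdist_triangle_abs by (intro divide_right_mono) auto
    finally show ?thesis .
  qed
  have near: "cmod (\<rho> x *\<^sub>R V x - \<rho> y *\<^sub>R V y) \<le> (M / \<delta> + L) * dist x y" if x: "x \<in> N" for x y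
  proof -
    have "\<rho> y * cmod (V x - V y) \<le> L * dist x y"
    proof (cases "y \<in> N")
      case True
      have "\<rho> y * cmod (V x - V y) \<le> 1 * cmod (V x - V y)" using \<rho> by (intro mult_right_mono) auto
      then show ?thesis using lipschitz_onD[OF L x True] by (simp add: dist_norm)
    qed (use \<rho>0 L0 in simp)
    moreover have "\<bar>\<rho> x - \<rho> y\<bar> * cmod (V x) \<le> dist x y / \<delta> * M"
      using \<rho>L M x \<delta>(1) by (intro mult_mono) auto
    moreover have "\<rho> x *\<^sub>R V x - \<rho> y *\<^sub>R V y = (\<rho> x - \<rho> y) *\<^sub>R V x + \<rho> y *\<^sub>R (V x - V y)"
      by (simp add: algebra_simps)
    then have "cmod (\<rho> x *\<^sub>R V x - \<rho> y *\<^sub>R V y)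
        \<le> \<bar>\<rho> x - \<rho> y\<bar> * cmod (V x) + \<rho> y * cmod (V x - V y)"
      using norm_triangle_ineq[of "(\<rho> x - \<rho> y) *\<^sub>R V x" "\<rho> y *\<^sub>R (V x - V y)"] \<rho>(1)[of y] by simp
    ultimately show ?thesis by (simp add: algebra_simps)
  qed
  show thesis
  proof (rule that)
    show "(M / \<delta> + L)-lipschitz_on UNIV (\<lambda>x. \<rho> x *\<^sub>R V x)"
    proof (rule lipschitz_onI)
      show nn: "0 \<le> M / \<delta> + L" using M \<delta>(1) L0 by simp
      fix x y
      show "dist (\<rho> x *\<^sub>R V x) (\<rho> y *\<^sub>R V y) \<le> (M / \<delta> + L) * dist x y"
      proof -
        consider "x \<in> N" | "y \<in> N" | "x \<notin> N" "y \<notin> N" by blast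
        then show ?thesis
        proof cases
          case 1
          then show ?thesis using near[of x y] by (simp add: dist_norm)
        next
          case 2
          then show ?thesis using near[of y x] by (simp add: dist_norm norm_minus_commute)
        next
          case 3
          then show ?thesis using \<rho>0 nn by simp
        qed
      qed
    qed
    have "cmod (\<rho> x *\<^sub>R V x) \<le> M" for x
    proof (cases "x \<in> N")
      case True
      have "\<rho> x * cmod (V x) \<le> 1 * cmod (V x)" using \<rho> by (intro mult_right_mono) auto
      then show ?thesis using M(1)[OF True] \<rho>(1)[of x] by simp
    qed (use \<rho>0 M in simp)
    then show "bounded (range (\<lambda>x. \<rho> x *\<^sub>R V x))" by (auto simp: bounded_iff)
    show "\<rho> x = 1" if "x \<in> K" for x using that by (simp add: \<rho>_def)
  qed
qed

text \<open>The solution of the cut-off equation stays in the sublevel set of its starting point: the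
  times at which it lies in this set form a closed set, and an open one because the trajectory
  remains in the domain for a while, where the rescaled field still conserves \<open>R\<close>.
  On the sublevel set the cut-off field is the original one.\<close>

theorem global_solution_with_compact_sublevel:
  fixes V :: "complex \<Rightarrow> complex" and R :: "complex \<Rightarrow> real"
  assumes \<Omega>: "open \<Omega>" and R: "\<And>x. x \<in> \<Omega> \<Longrightarrow> (R has_derivative D x) (at x)"
    and DV: "\<And>x. x \<in> \<Omega> \<Longrightarrow> D x (V x) = 0"
    and V: "\<And>N. compact N \<Longrightarrow> N \<subseteq> \<Omega> \<Longrightarrow> \<exists>L. L-lipschitz_on N V"
    and z0: "z0 \<in> \<Omega>" and cpt: "compact {x \<in> \<Omega>. R x \<le> R z0}"
  obtains z where "z 0 = z0"
    "\<And>t. 0 \<le> t \<Longrightarrow> z t \<in> \<Omega> \<and> (z has_vector_derivative V (z t)) (at t within {0..})"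
proof -
  define K where "K = {x \<in> \<Omega>. R x \<le> R z0}"
  have K: "compact K" "K \<subseteq> \<Omega>" "K \<noteq> {}" "z0 \<in> K" using cpt z0 by (auto simp: K_def)
  obtain \<rho> L where \<rho>: "L-lipschitz_on UNIV (\<lambda>x. \<rho> x *\<^sub>R V x)" "bounded (range (\<lambda>x. \<rho> x *\<^sub>R V x))"
    "\<And>x. x \<in> K \<Longrightarrow> \<rho> x = (1::real)"
    by (rule lipschitz_cutoff[OF \<Omega> K(1-3)]) (erule (1) V, rule that)
  define W where "W x = \<rho> x *\<^sub>R V x" for x
  obtain z where z: "z 0 = z0" "\<And>t. 0 \<le> t \<Longrightarrow> (z has_vector_derivative W (z t)) (at t within {0..})"
    by (rule lipschitz_ode_global_solution[OF \<rho>(1,2), folded W_def, of z0]) (rule that)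
  have DW: "D x (W x) = 0" if "x \<in> \<Omega>" for x
    using linear_scale[OF has_derivative_linear[OF R[OF that]]] DV[OF that] by (simp add: W_def)
  have cz: "continuous_on {0..} z"
    unfolding continuous_on_eq_continuous_within
    using z(2) has_vector_derivative_continuous by fastforce
  define A where "A = {0..} \<inter> z -` K"
  have "closedin (top_of_set {0..}) A"
    unfolding A_def by (rule continuous_closedin_preimage[OF cz compact_imp_closed[OF K(1)]])
  moreover have "openin (top_of_set {0..}) A"
    unfolding openin_euclidean_subtopology_iff
  proof (intro conjI ballI)
    show "A \<subseteq> {0..}" by (auto simp: A_def)
    fix t assume t: "t \<in> A"
    then have t0: "0 \<le> t" "z t \<in> K" by (auto simp: A_def)
    have "openin (top_of_set {0..}) ({0..} \<inter> z -` \<Omega>)" by (rule continuous_openin_preimage_gen[OF cz \<Omega>])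
    moreover have "t \<in> {0..} \<inter> z -` \<Omega>" using t0 K(2) by auto
    ultimately have "\<exists>e>0. \<forall>s\<in>{0..}. dist s t < e \<longrightarrow> s \<in> {0..} \<inter> z -` \<Omega>"
      unfolding openin_euclidean_subtopology_iff by (simp only:)
    then obtain e where e: "0 < e" "\<And>s. 0 \<le> s \<Longrightarrow> dist s t < e \<Longrightarrow> z s \<in> \<Omega>" by auto
    let ?S = "{0..} \<inter> ball t e"
    have "R (z s) = R (z t)" if s: "s \<in> ?S" for s
    proof (rule conserved_along_solution[where S = ?S and V = W and D = D])
      show "convex ?S" by (intro convex_Int) auto
      fix r assume r: "r \<in> ?S"
      then have "z r \<in> \<Omega>" using e(2)[of r] by (auto simp: dist_commute)
      then show "(R has_derivative D (z r)) (at (z r))" "D (z r) (W (z r)) = 0" using R DW by auto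
      show "(z has_vector_derivative W (z r)) (at r within ?S)"
        by (rule has_vector_derivative_within_subset[OF z(2)]) (use r in auto)
    qed (use s t0 e in auto)
    then have "\<forall>s\<in>{0..}. dist s t < e \<longrightarrow> s \<in> A"
      using e(2) t0 by (auto simp: A_def K_def dist_commute)
    then show "\<exists>e>0. \<forall>s\<in>{0..}. dist s t < e \<longrightarrow> s \<in> A" using e(1) by blast
  qed
  moreover have "A \<noteq> {}" using z(1) K(4) by (auto simp: A_def)
  ultimately have "A = {0..}" using connected_clopen[of "{0::real..}"] by auto
  then have "z t \<in> K" if "0 \<le> t" for t using that by (auto simp: A_def)
  then show thesis using z K(2) \<rho>(3) by (intro that[of z]) (auto simp: W_def)
qed

section \<open>Point vortex trajectories\<close>

lemma stationary_point_conformal: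
  assumes \<Omega>: "open \<Omega>" "bounded \<Omega>" and G: "green_function \<Omega> G" and \<gamma>: "regular_part \<Omega> G \<gamma>"
    and T: "biholomorphism T \<Omega> (ball 0 1)" and x0: "x0 \<in> \<Omega>" "T x0 = 0" "(deriv ^^ 2) T x0 = 0"
  shows "robin_field T x0 = 0" and "stationary_point \<gamma> x0"
proof -
  have "deriv (deriv T) x0 = 0" using x0(3) by (simp add: numeral_2_eq_2)
  then show F: "robin_field T x0 = 0" unfolding robin_field_def using x0(2) by simp
  have "grad (robin \<gamma>) x0 = robin_field T x0 /\<^sub>R (2 * pi)"
    by (rule grad_eqI[OF robin_has_derivative[OF \<Omega> G \<gamma> T x0(1)]])
  then show "stationary_point \<gamma> x0" by (simp only: stationary_point_def F scaleR_zero_right)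
qed

lemma vortex_velocity:
  assumes \<Omega>: "open \<Omega>" "bounded \<Omega>" and G: "green_function \<Omega> G" and \<gamma>: "regular_part \<Omega> G \<gamma>"
    and T: "biholomorphism T \<Omega> (ball 0 1)" and x: "x \<in> \<Omega>"
  shows "(a / 2) *\<^sub>R perp (grad (robin \<gamma>) x) = of_real (a / (4 * pi)) * \<i> * robin_field T x"
  unfolding grad_eqI[OF robin_has_derivative[OF assms]] perp_def
  by (simp add: complex_eq_iff) (simp add: field_simps)

text \<open>The velocity of a vortex is the gradient of the Robin function turned by a right angle;
  this orthogonality is the conservation law.\<close>

lemma inner_rotated_eq_0: "(c *\<^sub>R w) \<bullet> (of_real k * \<i> * w) = 0"
  by (simp add: inner_complex_def)

lemma robin_conserved:
  assumes \<Omega>: "open \<Omega>" "bounded \<Omega>" and G: "green_function \<Omega> G" and \<gamma>: "regular_part \<Omega> G \<gamma>"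
    and T: "biholomorphism T \<Omega> (ball 0 1)" and z: "point_vortex \<Omega> \<gamma> a z" and t: "0 \<le> t"
  shows "robin \<gamma> (z t) = robin \<gamma> (z 0)"
proof (rule conserved_along_solution[where S = "{0..}"
      and V = "\<lambda>x. of_real (a / (4 * pi)) * \<i> * robin_field T x"
      and D = "\<lambda>x h. (robin_field T x /\<^sub>R (2 * pi)) \<bullet> h"])
  fix t :: real assume "t \<in> {0..}"
  then have zt: "z t \<in> \<Omega>" and d: "(z has_vector_derivative (a / 2) *\<^sub>R perp (grad (robin \<gamma>) (z t))) (at t within {0..})"
    using z by (auto simp: point_vortex_def)
  show "(z has_vector_derivative of_real (a / (4 * pi)) * \<i> * robin_field T (z t)) (at t within {0..})"
    using d unfolding vortex_velocity[OF \<Omega> G \<gamma> T zt] .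
  show "(robin \<gamma> has_derivative (\<lambda>h. (robin_field T (z t) /\<^sub>R (2 * pi)) \<bullet> h)) (at (z t))"
    by (rule robin_has_derivative[OF \<Omega> G \<gamma> T zt])
  show "(robin_field T (z t) /\<^sub>R (2 * pi)) \<bullet> (of_real (a / (4 * pi)) * \<i> * robin_field T (z t)) = 0"
    by (rule inner_rotated_eq_0)
next
  show "convex {0::real..}" by (rule convex_real_interval)
  show "t \<in> {0..}" "0 \<in> {0::real..}" using t by simp_all
qed

theorem point_vortex_exists:
  assumes \<Omega>: "open \<Omega>" "bounded \<Omega>" and G: "green_function \<Omega> G" and \<gamma>: "regular_part \<Omega> G \<gamma>"
    and T: "biholomorphism T \<Omega> (ball 0 1)" and z0: "z0 \<in> \<Omega>"
  obtains z where "point_vortex \<Omega> \<gamma> a z" "z 0 = z0"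
proof -
  define V where "V x = of_real (a / (4 * pi)) * \<i> * robin_field T x" for x
  obtain P N where PN: "\<And>x. x \<in> \<Omega> \<Longrightarrow> (robin_field T has_derivative (\<lambda>h. P x * h + N x * cnj h)) (at x)"
    "continuous_on \<Omega> P" "continuous_on \<Omega> N"
    by (rule robin_field_has_derivative[OF \<Omega>(1) T]) (rule that)
  have VD: "(V has_derivative (\<lambda>h. (of_real (a / (4 * pi)) * \<i> * P x) * h
      + (of_real (a / (4 * pi)) * \<i> * N x) * cnj h)) (at x)" if "x \<in> \<Omega>" for x
    unfolding V_def
    by (rule has_derivative_eq_rhs[OF has_derivative_mult_right[OF PN(1)[OF that]]])
      (simp only: distrib_left mult.assoc)
  show thesis
  proof (rule global_solution_with_compact_sublevel[where V = V and R = "robin \<gamma>"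
        and D = "\<lambda>x h. (robin_field T x /\<^sub>R (2 * pi)) \<bullet> h", OF \<Omega>(1) _ _ _ z0
        robin_sublevel_compact[OF \<Omega> G \<gamma> T]])
    show "(robin \<gamma> has_derivative (\<lambda>h. (robin_field T x /\<^sub>R (2 * pi)) \<bullet> h)) (at x)" if "x \<in> \<Omega>" for x
      by (rule robin_has_derivative[OF \<Omega> G \<gamma> T that])
    show "(robin_field T x /\<^sub>R (2 * pi)) \<bullet> V x = 0" for x
      unfolding V_def by (rule inner_rotated_eq_0)
    show "\<exists>L. L-lipschitz_on K V" if K: "compact K" "K \<subseteq> \<Omega>" for K
    proof -
      obtain L where "L-lipschitz_on K V"
      proof (rule lipschitz_on_compact_if_C1[OF \<Omega>(1) _ _ _ K])
        show "(V has_derivative (\<lambda>h. (of_real (a / (4 * pi)) * \<i> * P x) * h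
            + (of_real (a / (4 * pi)) * \<i> * N x) * cnj h)) (at x)" if "x \<in> \<Omega>" for x
          by (rule VD[OF that])
      qed (intro continuous_intros PN(2,3))+
      then show ?thesis by blast
    qed
  next
    fix z assume z: "z 0 = z0"
      "\<And>t. 0 \<le> t \<Longrightarrow> z t \<in> \<Omega> \<and> (z has_vector_derivative V (z t)) (at t within {0..})"
    have "point_vortex \<Omega> \<gamma> a z"
      unfolding point_vortex_def using z(2) vortex_velocity[OF \<Omega> G \<gamma> T] by (simp add: V_def)
    then show thesis using z(1) by (rule that)
  qed
qed

section \<open>Elliptic critical points\<close>

lemma linearization_error:
  fixes F :: "'a::real_normed_vector \<Rightarrow> 'b::real_normed_vector"
  assumes "(F has_derivative D) (at x0)" "F x0 = 0" "0 < \<delta>" "open \<Omega>" "x0 \<in> \<Omega>"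
  obtains r where "0 < r" "\<And>h. norm h < r \<Longrightarrow> x0 + h \<in> \<Omega> \<and> norm (F (x0 + h) - D h) \<le> \<delta> * norm h"
proof -
  obtain d where d: "0 < d" "\<And>y. norm (y - x0) < d \<Longrightarrow> norm (F y - F x0 - D (y - x0)) \<le> \<delta> * norm (y - x0)"
    using assms(1,3) unfolding has_derivative_at_alt by blast
  obtain e where e: "0 < e" "ball x0 e \<subseteq> \<Omega>" using assms(4,5) open_contains_ball by blast
  show thesis
  proof (rule that[of "min d e"])
    fix h :: 'a assume h: "norm h < min d e"
    have "x0 + h \<in> ball x0 e" using h by (simp add: dist_norm)
    then show "x0 + h \<in> \<Omega> \<and> norm (F (x0 + h) - D h) \<le> \<delta> * norm h"
      using e(2) d(2)[of "x0 + h"] h assms(2) by auto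
  qed (use d e in auto)
qed

lemma DERIV_nonneg_imp_le:
  fixes f :: "real \<Rightarrow> real"
  assumes "a \<le> b" "continuous_on {a..b} f"
    and D: "\<And>x. a < x \<Longrightarrow> x < b \<Longrightarrow> (f has_real_derivative f' x) (at x)"
    and nn: "\<And>x. a < x \<Longrightarrow> x < b \<Longrightarrow> 0 \<le> f' x"
  shows "f a \<le> f b"
proof (cases "a = b")
  case False
  then have ab: "a < b" using assms(1) by simp
  have "f differentiable (at x)" if "a < x" "x < b" for x
    using D[OF that] unfolding real_differentiable_def by blast
  from MVT[OF ab assms(2) this] obtain l z where
    z: "a < z" "z < b" "(f has_real_derivative l) (at z)" "f b - f a = (b - a) * l" by blast
  have "l = f' z" using DERIV_unique[OF z(3) D[OF z(1,2)]] .
  then have "0 \<le> (b - a) * l" using ab nn[OF z(1,2)] by simp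
  then show ?thesis using z(4) by simp
qed simp

text \<open>Integrates a lower bound on the radial component of the gradient along the segment from
  \<open>x0\<close>. Used for \<open>R\<close> and for \<open>- R\<close>.\<close>

lemma radial_growth:
  fixes R :: "'a::real_inner \<Rightarrow> real"
  assumes R: "\<And>h. norm h < r \<Longrightarrow> (R has_derivative (\<lambda>v. F (x0 + h) \<bullet> v)) (at (x0 + h))"
    and lower: "\<And>h. norm h < r \<Longrightarrow> 2 * A * (norm h)\<^sup>2 \<le> F (x0 + h) \<bullet> h" and w: "norm w < r"
  shows "A * (norm w)\<^sup>2 \<le> R (x0 + w) - R x0"
proof -
  define f where "f t = R (x0 + t *\<^sub>R w) - A * (norm w)\<^sup>2 * t\<^sup>2" for t
  have D: "(f has_real_derivative F (x0 + t *\<^sub>R w) \<bullet> w - A * (norm w)\<^sup>2 * (2 * t)) (at t)"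
    and tw: "norm (t *\<^sub>R w) < r" if t: "0 \<le> t" "t \<le> 1" for t
  proof -
    have "t * norm w \<le> 1 * norm w" using t by (intro mult_right_mono) auto
    then show tw: "norm (t *\<^sub>R w) < r" using t w by simp
    show "(f has_real_derivative F (x0 + t *\<^sub>R w) \<bullet> w - A * (norm w)\<^sup>2 * (2 * t)) (at t)"
      unfolding f_def
      by (rule DERIV_diff[OF has_real_derivative_along_line[OF R[OF tw]]])
        (auto intro!: derivative_eq_intros)
  qed
  have "f 0 \<le> f 1"
  proof (rule DERIV_nonneg_imp_le[where f = f and a = 0 and b = 1 and f' = "\<lambda>t. F (x0 + t *\<^sub>R w) \<bullet> w - A * (norm w)\<^sup>2 * (2 * t)"])
    fix t :: real assume t: "0 < t" "t < 1"
    show "(f has_real_derivative F (x0 + t *\<^sub>R w) \<bullet> w - A * (norm w)\<^sup>2 * (2 * t)) (at t)"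
      by (rule D) (use t in auto)
    have "norm (t *\<^sub>R w) < r" by (rule tw) (use t in auto)
    from lower[OF this] have "0 \<le> t * (F (x0 + t *\<^sub>R w) \<bullet> w - A * (norm w)\<^sup>2 * (2 * t))"
      using t by (simp add: power2_eq_square algebra_simps)
    then show "0 \<le> F (x0 + t *\<^sub>R w) \<bullet> w - A * (norm w)\<^sup>2 * (2 * t)"
      using t by (simp add: zero_le_mult_iff)
  next
    show "continuous_on {0..1} f"
      by (intro continuous_at_imp_continuous_on ballI DERIV_isCont[OF D]) auto
  qed simp
  then show ?thesis by (simp add: f_def)
qed

text \<open>The quadratic form of \<open>h \<mapsto> 2 m h + cnj (s h)\<close> lies between \<open>(2 m - \<bar>s\<bar>) \<bar>h\<bar>\<^sup>2\<close> and
  \<open>(2 m + \<bar>s\<bar>) \<bar>h\<bar>\<^sup>2\<close>; an error \<open>e\<close> of relative size \<open>\<delta>\<close> shifts the bounds by \<open>\<delta> \<bar>h\<bar>\<^sup>2\<close>.\<close>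

lemma norm_inner_quadratic_bounds:
  fixes h s e :: complex and m \<delta> :: real
  assumes m: "0 \<le> m" and e: "cmod e \<le> \<delta> * cmod h"
  shows "(2 * m - cmod s - \<delta>) * (cmod h)\<^sup>2 \<le> (of_real (2 * m) * h + cnj s * cnj h + e) \<bullet> h"
    and "(of_real (2 * m) * h + cnj s * cnj h + e) \<bullet> h \<le> (2 * m + cmod s + \<delta>) * (cmod h)\<^sup>2"
proof -
  have 1: "(of_real (2 * m) * h) \<bullet> h = 2 * m * (cmod h)\<^sup>2"
    unfolding cmod_power2 inner_complex_def by (simp add: power2_eq_square algebra_simps)
  have 2: "\<bar>(cnj s * cnj h) \<bullet> h\<bar> \<le> cmod s * (cmod h)\<^sup>2"
    using Cauchy_Schwarz_ineq2[of "cnj s * cnj h" h] by (simp add: norm_mult power2_eq_square mult.assoc)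
  have "\<bar>e \<bullet> h\<bar> \<le> cmod e * cmod h" by (rule Cauchy_Schwarz_ineq2)
  also have "\<dots> \<le> \<delta> * cmod h * cmod h" using e by (rule mult_right_mono) simp
  finally have 3: "\<bar>e \<bullet> h\<bar> \<le> \<delta> * (cmod h)\<^sup>2" by (simp add: power2_eq_square mult.assoc)
  show "(2 * m - cmod s - \<delta>) * (cmod h)\<^sup>2 \<le> (of_real (2 * m) * h + cnj s * cnj h + e) \<bullet> h"
    using 1 2 3 unfolding inner_add_left left_diff_distrib by linarith
  show "(of_real (2 * m) * h + cnj s * cnj h + e) \<bullet> h \<le> (2 * m + cmod s + \<delta>) * (cmod h)\<^sup>2"
    using 1 2 3 unfolding inner_add_left distrib_right by linarith
qed

lemma quadratic_bounds_at_elliptic_point: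
  fixes R :: "complex \<Rightarrow> real" and F :: "complex \<Rightarrow> complex" and m k :: real
  assumes \<Omega>: "open \<Omega>" "x0 \<in> \<Omega>" and k: "0 < k"
    and R: "\<And>x. x \<in> \<Omega> \<Longrightarrow> (R has_derivative (\<lambda>v. (k *\<^sub>R F x) \<bullet> v)) (at x)"
    and F: "F x0 = 0" "(F has_derivative (\<lambda>h. of_real (2 * m) * h + cnj s * cnj h)) (at x0)"
    and s: "cmod s < 2 * m"
  obtains r A B where "0 < r" "0 < A" "0 < B"
    "\<And>w. cmod w < r \<Longrightarrow> A * (cmod w)\<^sup>2 \<le> R (x0 + w) - R x0 \<and> R (x0 + w) - R x0 \<le> B * (cmod w)\<^sup>2"
proof -
  define \<delta> where "\<delta> = (2 * m - cmod s) / 2"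
  have \<delta>: "0 < \<delta>" "2 * m - cmod s - \<delta> = \<delta>" using s unfolding \<delta>_def by argo+
  have m: "0 < m" using s norm_ge_zero[of s] by linarith
  obtain r where r: "0 < r" and r': "\<And>h. cmod h < r \<Longrightarrow> x0 + h \<in> \<Omega> \<and>
      cmod (F (x0 + h) - (of_real (2 * m) * h + cnj s * cnj h)) \<le> \<delta> * cmod h"
    using linearization_error[OF F(2,1) \<delta>(1) \<Omega>] by blast
  have b: "\<delta> * (cmod h)\<^sup>2 \<le> F (x0 + h) \<bullet> h"
    "F (x0 + h) \<bullet> h \<le> (2 * m + cmod s + \<delta>) * (cmod h)\<^sup>2" if "cmod h < r" for h
    using norm_inner_quadratic_bounds[OF less_imp_le[OF m] conjunct2[OF r'[OF that]], of s] \<delta>(2) by simp_all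
  define A where "A = k * \<delta> / 2"
  define B where "B = k * (2 * m + cmod s + \<delta>) / 2"
  have AB: "0 < A" "0 < B" using k \<delta> m by (auto simp: A_def B_def intro!: mult_pos_pos add_pos_pos add_pos_nonneg)
  have "A * (cmod w)\<^sup>2 \<le> R (x0 + w) - R x0" if w: "cmod w < r" for w
  proof (rule radial_growth[where F = "\<lambda>x. k *\<^sub>R F x", OF _ _ w])
    show "(R has_derivative (\<lambda>v. (k *\<^sub>R F (x0 + h)) \<bullet> v)) (at (x0 + h))" if "cmod h < r" for h
      using R r' that by blast
    show "2 * A * (cmod h)\<^sup>2 \<le> (k *\<^sub>R F (x0 + h)) \<bullet> h" if "cmod h < r" for h
      using mult_left_mono[OF b(1)[OF that] less_imp_le[OF k]] by (simp add: A_def mult.assoc)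
  qed
  moreover have "- B * (cmod w)\<^sup>2 \<le> - R (x0 + w) - - R x0" if w: "cmod w < r" for w
  proof (rule radial_growth[where F = "\<lambda>x. - k *\<^sub>R F x", OF _ _ w])
    show "((\<lambda>x. - R x) has_derivative (\<lambda>v. (- k *\<^sub>R F (x0 + h)) \<bullet> v)) (at (x0 + h))"
      if "cmod h < r" for h
      using has_derivative_minus[OF R[of "x0 + h"]] r'[OF that] by simp
    show "2 * - B * (cmod h)\<^sup>2 \<le> (- k *\<^sub>R F (x0 + h)) \<bullet> h" if "cmod h < r" for h
      using mult_left_mono[OF b(2)[OF that] less_imp_le[OF k]] by (simp add: B_def mult.assoc)
  qed
  then have "R (x0 + w) - R x0 \<le> B * (cmod w)\<^sup>2" if "cmod w < r" for w
    using that by fastforce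
  ultimately show thesis using r AB by (intro that[of r A B]) auto
qed

text \<open>A trajectory that left the disk would cross the circle of radius \<open>(B / A + 1) \<epsilon>\<close>. There \<open>R\<close>
  exceeds \<open>R x0\<close> by more than \<open>B \<epsilon>\<^sup>2\<close>, which is more than its value at the start allows.\<close>

lemma trapped_by_conserved_quantity:
  fixes z :: "real \<Rightarrow> complex" and R :: "complex \<Rightarrow> real"
  assumes cont: "continuous_on {0..} z" and cons: "\<And>t. 0 \<le> t \<Longrightarrow> R (z t) = R (z 0)"
    and AB: "0 < A" "0 < B"
    and bounds: "\<And>w. cmod w < r \<Longrightarrow> A * (cmod w)\<^sup>2 \<le> R (x0 + w) - R x0 \<and> R (x0 + w) - R x0 \<le> B * (cmod w)\<^sup>2"
    and \<epsilon>: "0 < \<epsilon>" "(B / A + 1) * \<epsilon> < r" and z0: "cmod (z 0 - x0) < \<epsilon>" and t: "0 \<le> t"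
  shows "cmod (z t - x0) < (B / A + 1) * \<epsilon>"
proof (rule ccontr)
  \<comment> \<open>With this choice \<open>C > 1\<close> and \<open>B < A C\<close>, hence \<open>B < A C\<^sup>2\<close>.\<close>
  define C where "C = B / A + 1"
  have C: "1 < C" "B < A * C" using AB by (simp_all add: C_def field_simps)
  assume "\<not> cmod (z t - x0) < (B / A + 1) * \<epsilon>"
  then have "C * \<epsilon> \<le> cmod (z t - x0)" by (simp add: C_def)
  moreover have "\<epsilon> \<le> C * \<epsilon>" using C \<epsilon> by simp
  then have "cmod (z 0 - x0) \<le> C * \<epsilon>" using z0 by simp
  moreover have "continuous_on {0..t} (\<lambda>t. cmod (z t - x0))"
    by (intro continuous_intros continuous_on_subset[OF cont]) auto
  ultimately obtain u where u: "0 \<le> u" "cmod (z u - x0) = C * \<epsilon>"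
    using IVT'[of "\<lambda>t. cmod (z t - x0)" 0 "C * \<epsilon>" t] t by auto
  have "A * (C * \<epsilon>)\<^sup>2 \<le> R (z u) - R x0"
    using bounds[of "z u - x0"] u \<epsilon>(2) by (simp add: C_def)
  also have "\<dots> \<le> B * (cmod (z 0 - x0))\<^sup>2"
    using bounds[of "z 0 - x0"] cons[OF u(1)] z0 \<open>\<epsilon> \<le> C * \<epsilon>\<close> \<epsilon>(2) by (simp add: C_def)
  also have "\<dots> \<le> B * \<epsilon>\<^sup>2" using AB z0 by (intro mult_left_mono power_mono) auto
  finally have "A * C * C * \<epsilon>\<^sup>2 \<le> B * \<epsilon>\<^sup>2" by (simp add: power2_eq_square mult_ac)
  then have "A * C * C \<le> B" using \<epsilon>(1) by simp
  moreover have "A * C * 1 \<le> A * C * C" using C AB by (intro mult_left_mono) auto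
  ultimately show False using C by simp
qed

lemma exit_time_eq_infinity:
  assumes "\<And>t. 0 \<le> t \<Longrightarrow> cmod (z t - x0) \<le> \<epsilon> powr \<beta>"
  shows "exit_time x0 z \<epsilon> \<beta> = \<infinity>"
proof -
  have "of_nat n \<le> exit_time x0 z \<epsilon> \<beta>" for n
    unfolding exit_time_def
    by (rule Sup_upper) (use assms in \<open>auto intro!: exI[of _ "real n"] simp: ennreal_of_nat_eq_real_of_nat\<close>)
  then have "(SUP n. of_nat n) \<le> exit_time x0 z \<epsilon> \<beta>" by (intro SUP_least)
  then show ?thesis unfolding ennreal_SUP_of_nat_eq_top by (simp add: top_unique)
qed

lemma mult_le_powr_if_small:
  fixes \<beta> c :: real
  assumes "0 < \<beta>" "\<beta> < 1" "0 < C" and \<epsilon>: "0 < \<epsilon>" "\<epsilon> \<le> (1 / C) powr (1 / (1 - \<beta>))"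
  shows "C * \<epsilon> \<le> \<epsilon> powr \<beta>"
proof -
  have "\<epsilon> powr (1 - \<beta>) \<le> ((1 / C) powr (1 / (1 - \<beta>))) powr (1 - \<beta>)"
    using assms by (intro powr_mono2) auto
  also have "\<dots> = 1 / C" using assms by (simp add: powr_powr)
  finally have "C * \<epsilon> powr (1 - \<beta>) \<le> 1" using assms(3) by (simp add: field_simps)
  then have "C * \<epsilon> powr (1 - \<beta>) * \<epsilon> powr \<beta> \<le> 1 * \<epsilon> powr \<beta>" by (rule mult_right_mono) simp
  then show ?thesis using \<epsilon>(1) by (simp add: mult.assoc powr_add[symmetric])
qed

section \<open>Saddle points\<close>

lemma escape_rate:
  fixes f :: "real \<Rightarrow> real"
  assumes t: "0 \<le> t" and cont: "continuous_on {0..t} f"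
    and f: "\<And>s. 0 < s \<Longrightarrow> s < t \<Longrightarrow> (f has_real_derivative f' s) (at s)"
    and growth: "\<And>s. 0 < s \<Longrightarrow> s < t \<Longrightarrow> c * f s \<le> f' s"
  shows "f 0 * exp (c * t) \<le> f t"
proof -
  have "f 0 * exp (- c * 0) \<le> f t * exp (- c * t)"
  proof (rule DERIV_nonneg_imp_le[where a = 0 and b = t and f = "\<lambda>s. f s * exp (- c * s)"
        and f' = "\<lambda>s. (f' s - c * f s) * exp (- c * s)"])
    show "0 \<le> t" by (rule t)
    show "continuous_on {0..t} (\<lambda>s. f s * exp (- c * s))" by (intro continuous_intros cont)
    show "((\<lambda>s. f s * exp (- c * s)) has_real_derivative (f' s - c * f s) * exp (- c * s)) (at s)"
      if "0 < s" "s < t" for s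
      using f[OF that] by (auto intro!: derivative_eq_intros simp: algebra_simps)
    show "0 \<le> (f' s - c * f s) * exp (- c * s)" if "0 < s" "s < t" for s
      using growth[OF that] by simp
  qed
  from mult_right_mono[OF this, of "exp (c * t)"] show ?thesis
    by (simp add: exp_minus mult.assoc)
qed

text \<open>The right-hand side is half the time derivative of \<open>Im (\<eta> w\<^sup>2)\<close>. The condition on \<open>\<eta>\<close>
  aligns the phases such that the antilinear part of the velocity contributes its full modulus
  \<open>\<bar>\<kappa>\<bar> \<bar>s\<bar> \<bar>w\<bar>\<^sup>2\<close>, while the linear part can cost at most \<open>2 \<bar>\<kappa>\<bar> m \<bar>w\<bar>\<^sup>2\<close>.\<close>

lemma saddle_growth:
  fixes w e s \<eta> :: complex and m \<delta> \<kappa> :: real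
  assumes m: "0 \<le> m" and e: "cmod e \<le> \<delta> * cmod w" and \<eta>: "cmod \<eta> = 1" "of_real \<kappa> * \<eta> * cnj s = of_real (\<bar>\<kappa>\<bar> * cmod s)"
  shows "\<bar>\<kappa>\<bar> * (cmod s - 2 * m - \<delta>) * (cmod w)\<^sup>2
    \<le> Im (\<eta> * w * (of_real \<kappa> * \<i> * (of_real (2 * m) * w + cnj s * cnj w + e)))"
proof -
  have rot: "\<eta> * w * (of_real \<kappa> * \<i> * (of_real (2 * m) * w + cnj s * cnj w + e))
      = \<i> * (of_real \<kappa> * \<eta> * cnj s * (w * cnj w)
        + of_real \<kappa> * (\<eta> * (of_real (2 * m) * w * w)) + of_real \<kappa> * (\<eta> * w * e))"
    by (simp add: algebra_simps)
  have eq: "Im (\<eta> * w * (of_real \<kappa> * \<i> * (of_real (2 * m) * w + cnj s * cnj w + e)))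
      = \<bar>\<kappa>\<bar> * cmod s * (cmod w)\<^sup>2 + \<kappa> * Re (\<eta> * (of_real (2 * m) * w * w)) + \<kappa> * Re (\<eta> * w * e)"
  proof -
    have "Im (\<i> * (of_real p * of_real q + of_real \<kappa> * X + of_real \<kappa> * Y))
        = p * q + \<kappa> * Re X + \<kappa> * Re Y" for p q and X Y :: complex by simp
    then show ?thesis
      using rot unfolding \<eta>(2) complex_norm_square[symmetric] by (simp only:)
  qed
  have 1: "\<bar>\<kappa> * Re (\<eta> * (of_real (2 * m) * w * w))\<bar> \<le> \<bar>\<kappa>\<bar> * (2 * m * (cmod w)\<^sup>2)"
    unfolding abs_mult
    using abs_Re_le_cmod[of "\<eta> * (of_real (2 * m) * w * w)"] \<eta>(1) m
    by (intro mult_left_mono) (simp_all add: norm_mult power2_eq_square mult.assoc)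
  have "cmod (\<eta> * w * e) \<le> cmod w * (\<delta> * cmod w)"
    using mult_left_mono[OF e, of "cmod w"] \<eta>(1) by (simp add: norm_mult)
  then have 2: "\<bar>\<kappa> * Re (\<eta> * w * e)\<bar> \<le> \<bar>\<kappa>\<bar> * (\<delta> * (cmod w)\<^sup>2)"
    unfolding abs_mult
    using abs_Re_le_cmod[of "\<eta> * w * e"]
    by (intro mult_left_mono) (simp_all add: power2_eq_square mult_ac)
  show ?thesis using 1 2 unfolding eq by (simp add: algebra_simps)
qed

text \<open>Since \<open>Im (\<eta> w\<^sup>2)\<close> is at most \<open>\<bar>w\<bar>\<^sup>2\<close>, the growth bound for its derivative becomes a linear
  differential inequality, and the exponential lower bound it yields is compatible with
  \<open>\<bar>w\<bar> \<le> \<rho>\<close> only for a limited time.\<close>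

lemma saddle_escape_time:
  fixes z :: "real \<Rightarrow> complex" and F :: "complex \<Rightarrow> complex" and m \<delta> \<kappa> c :: real
  assumes z: "\<And>t. 0 \<le> t \<Longrightarrow> (z has_vector_derivative of_real \<kappa> * \<i> * F (z t)) (at t within {0..})"
    and F: "\<And>h. cmod h < r \<Longrightarrow> cmod (F (x0 + h) - (of_real (2 * m) * h + cnj s * cnj h)) \<le> \<delta> * cmod h"
    and m: "0 \<le> m" and c: "c = \<bar>\<kappa>\<bar> * (cmod s - 2 * m - \<delta>)" "0 < c"
    and \<eta>: "cmod \<eta> = 1" "of_real \<kappa> * \<eta> * cnj s = of_real (\<bar>\<kappa>\<bar> * cmod s)"
    and start: "Im (\<eta> * (z 0 - x0)\<^sup>2) = \<epsilon>\<^sup>2" and \<epsilon>: "0 < \<epsilon>"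
    and stay: "\<And>u. 0 \<le> u \<Longrightarrow> u \<le> t \<Longrightarrow> cmod (z u - x0) \<le> \<rho>" and \<rho>: "\<rho> < r" and t: "0 \<le> t"
  shows "\<epsilon>\<^sup>2 * exp (2 * c * t) \<le> \<rho>\<^sup>2"
proof -
  define w where "w u = z u - x0" for u
  define f where "f u = Im (\<eta> * (w u)\<^sup>2)" for u
  have Yle: "f u \<le> (cmod (w u))\<^sup>2" for u
    using abs_Im_le_cmod[of "\<eta> * (w u)\<^sup>2"] \<eta>(1) by (simp add: f_def norm_mult norm_power)
  have cz: "continuous_on {0..} z"
    unfolding continuous_on_eq_continuous_within
    using z has_vector_derivative_continuous by fastforce
  have "f 0 * exp (2 * c * t) \<le> f t"
  proof (rule escape_rate[OF t, where f' = "\<lambda>u. 2 * Im (\<eta> * w u * (of_real \<kappa> * \<i> * F (z u)))"])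
    show "continuous_on {0..t} f"
      unfolding f_def w_def by (intro continuous_intros continuous_on_subset[OF cz]) auto
    fix u assume u: "0 < u" "u < t"
    have "at u within {0..} = at u" using u by (intro at_within_interior) simp
    then have zu: "(z has_vector_derivative of_real \<kappa> * \<i> * F (z u)) (at u)" using z[of u] u by simp
    have "((\<lambda>u. \<eta> * (w u * w u)) has_vector_derivative
        \<eta> * (w u * (of_real \<kappa> * \<i> * F (z u)) + of_real \<kappa> * \<i> * F (z u) * w u)) (at u)"
      unfolding w_def
      by (intro has_vector_derivative_mult_right has_vector_derivative_mult
          has_vector_derivative_diff_const[THEN iffD2] zu)
    then have "((\<lambda>u. Im (\<eta> * (w u * w u))) has_vector_derivative
        Im (\<eta> * (w u * (of_real \<kappa> * \<i> * F (z u)) + of_real \<kappa> * \<i> * F (z u) * w u))) (at u)"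
      by (rule bounded_linear.has_vector_derivative[OF bounded_linear_Im])
    moreover have "Im (\<eta> * (w u * v + v * w u)) = 2 * Im (\<eta> * w u * v)" for v
      by (simp add: algebra_simps)
    ultimately show "(f has_real_derivative 2 * Im (\<eta> * w u * (of_real \<kappa> * \<i> * F (z u)))) (at u)"
      unfolding f_def[abs_def] has_real_derivative_iff_has_vector_derivative power2_eq_square
      by (simp only:)
    define e where "e = F (z u) - (of_real (2 * m) * w u + cnj s * cnj (w u))"
    have "cmod (w u) < r" using stay[of u] u \<rho> by (simp add: w_def)
    from F[OF this] have "cmod e \<le> \<delta> * cmod (w u)" by (simp add: e_def w_def)
    from saddle_growth[OF m this \<eta>]
    have "c * (cmod (w u))\<^sup>2 \<le> Im (\<eta> * w u * (of_real \<kappa> * \<i> * F (z u)))"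
      by (simp add: e_def c(1))
    moreover have "c * f u \<le> c * (cmod (w u))\<^sup>2" using Yle c(2) by (intro mult_left_mono) auto
    ultimately show "2 * c * f u \<le> 2 * Im (\<eta> * w u * (of_real \<kappa> * \<i> * F (z u)))" by simp
  qed
  also have "\<dots> \<le> (cmod (w t))\<^sup>2" by (rule Yle)
  also have "\<dots> \<le> \<rho>\<^sup>2" using stay[of t] t by (intro power_mono) (auto simp: w_def)
  finally show ?thesis using start by (simp add: f_def w_def)
qed

section \<open>Stability and instability of the stationary point\<close>

lemma robin_field_linearization:
  assumes \<Omega>: "open \<Omega>" and T: "biholomorphism T \<Omega> (ball 0 1)"
    and x0: "x0 \<in> \<Omega>" "T x0 = 0" "(deriv ^^ 2) T x0 = 0"
  shows "(robin_field T has_derivative (\<lambda>h. of_real (2 * (cmod (deriv T x0))\<^sup>2) * h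
    + cnj ((deriv ^^ 3) T x0 / deriv T x0) * cnj h)) (at x0)"
proof -
  obtain P N where D: "\<And>x. x \<in> \<Omega> \<Longrightarrow> (robin_field T has_derivative (\<lambda>h. P x * h + N x * cnj h)) (at x)"
    and PN: "\<And>x. x \<in> \<Omega> \<Longrightarrow> T x = 0 \<Longrightarrow> (deriv ^^ 2) T x = 0 \<Longrightarrow>
       P x = of_real (2 * (cmod (deriv T x))\<^sup>2) \<and> N x = cnj ((deriv ^^ 3) T x / deriv T x)"
    by (rule robin_field_has_derivative[OF \<Omega> T]) (rule that)
  show ?thesis using D[OF x0(1)] PN[OF x0] by (simp only:)
qed

text \<open>The hypothesis says that both eigenvalues of the linearized gradient are positive.\<close>

lemma point_vortex_stable:
  assumes \<Omega>: "open \<Omega>" "bounded \<Omega>" and G: "green_function \<Omega> G" and \<gamma>: "regular_part \<Omega> G \<gamma>"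
    and T: "biholomorphism T \<Omega> (ball 0 1)" and x0: "x0 \<in> \<Omega>" "T x0 = 0" "(deriv ^^ 2) T x0 = 0"
    and \<beta>: "0 < \<beta>" "\<beta> < 1"
    and elliptic: "cmod ((deriv ^^ 3) T x0) < 2 * cmod (deriv T x0) ^ 3"
  shows "\<exists>\<epsilon>0>0. \<exists>C>0. \<forall>\<epsilon>. 0 < \<epsilon> \<and> \<epsilon> \<le> \<epsilon>0 \<longrightarrow>
          (\<forall>z. point_vortex \<Omega> \<gamma> a z \<and> z 0 \<in> ball x0 \<epsilon> \<longrightarrow>
             (\<forall>t\<ge>0. z t \<in> ball x0 (C * \<epsilon>)) \<and> exit_time x0 z \<epsilon> \<beta> = \<infinity>)"
proof -
  define m where "m = (cmod (deriv T x0))\<^sup>2"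
  define s where "s = (deriv ^^ 3) T x0 / deriv T x0"
  have T': "deriv T x0 \<noteq> 0" using biholomorphism_diskD[OF T \<Omega>(1) x0(1)] by simp
  have s: "cmod s < 2 * m"
    using elliptic T' by (simp add: s_def m_def norm_divide divide_less_eq power2_eq_square power3_eq_cube mult.assoc)
  have F: "(robin_field T has_derivative (\<lambda>h. of_real (2 * m) * h + cnj s * cnj h)) (at x0)"
    unfolding m_def s_def by (rule robin_field_linearization[OF \<Omega>(1) T x0])
  have R: "(robin \<gamma> has_derivative (\<lambda>v. ((1 / (2 * pi)) *\<^sub>R robin_field T x) \<bullet> v)) (at x)" if "x \<in> \<Omega>" for x
    using robin_has_derivative[OF \<Omega> G \<gamma> T that] by (simp add: inverse_eq_divide)
  obtain r A B where r: "0 < r" and AB: "0 < A" "0 < B" and bounds: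
    "\<And>w. cmod w < r \<Longrightarrow> A * (cmod w)\<^sup>2 \<le> robin \<gamma> (x0 + w) - robin \<gamma> x0
      \<and> robin \<gamma> (x0 + w) - robin \<gamma> x0 \<le> B * (cmod w)\<^sup>2"
    by (rule quadratic_bounds_at_elliptic_point[OF \<Omega>(1) x0(1) _ R
          stationary_point_conformal(1)[OF \<Omega> G \<gamma> T x0] F s]) (simp, assumption, rule that)
  define C where "C = B / A + 1"
  have C: "0 < C" using AB by (simp add: C_def add_pos_pos)
  \<comment> \<open>The first bound keeps the trapping disk inside the region of the quadratic bounds, the second one inside the disk of radius \<open>\<epsilon> powr \<beta>\<close>.\<close>
  define \<epsilon>0 where "\<epsilon>0 = min (r / (2 * C)) ((1 / C) powr (1 / (1 - \<beta>)))"
  have \<epsilon>0: "0 < \<epsilon>0" using r C by (simp add: \<epsilon>0_def)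
  have main: "(\<forall>t\<ge>0. z t \<in> ball x0 (C * \<epsilon>)) \<and> exit_time x0 z \<epsilon> \<beta> = \<infinity>"
    if \<epsilon>: "0 < \<epsilon>" "\<epsilon> \<le> \<epsilon>0" and z: "point_vortex \<Omega> \<gamma> a z" and z0: "z 0 \<in> ball x0 \<epsilon>" for \<epsilon> z
  proof -
    have "C * \<epsilon> \<le> C * (r / (2 * C))" using \<epsilon> C by (intro mult_left_mono) (auto simp: \<epsilon>0_def)
    also have "\<dots> < r" using C r by simp
    finally have C\<epsilon>: "C * \<epsilon> < r" .
    have cont: "continuous_on {0..} z"
      unfolding continuous_on_eq_continuous_within
      using z has_vector_derivative_continuous by (fastforce simp: point_vortex_def)
    have trapped: "cmod (z t - x0) < C * \<epsilon>" if "0 \<le> t" for t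
      unfolding C_def
    proof (rule trapped_by_conserved_quantity[where R = "robin \<gamma>", OF cont _ AB bounds \<epsilon>(1)])
      show "robin \<gamma> (z t) = robin \<gamma> (z 0)" if "0 \<le> t" for t
        by (rule robin_conserved[OF \<Omega> G \<gamma> T z that])
      show "(B / A + 1) * \<epsilon> < r" using C\<epsilon> by (simp add: C_def)
      show "cmod (z 0 - x0) < \<epsilon>" using z0 by (simp add: dist_norm norm_minus_commute)
    qed (use that in auto)
    have "C * \<epsilon> \<le> \<epsilon> powr \<beta>" using \<epsilon> by (intro mult_le_powr_if_small \<beta> C) (auto simp: \<epsilon>0_def)
    then have "cmod (z t - x0) \<le> \<epsilon> powr \<beta>" if "0 \<le> t" for t using trapped[OF that] by simp
    then show ?thesis
      using trapped exit_time_eq_infinity by (simp add: dist_norm norm_minus_commute)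
  qed
  show ?thesis
    by (rule exI[of _ \<epsilon>0], rule conjI, rule \<epsilon>0, rule exI[of _ C], rule conjI, rule C) (use main in blast)
qed

text \<open>The hypothesis says that the linearized gradient has eigenvalues of opposite signs. The
  starting point is placed at distance \<open>\<epsilon>\<close> in the direction in which \<open>Im (\<eta> w\<^sup>2)\<close> is as large as
  possible.\<close>

lemma point_vortex_unstable:
  assumes \<Omega>: "open \<Omega>" "bounded \<Omega>" and G: "green_function \<Omega> G" and \<gamma>: "regular_part \<Omega> G \<gamma>"
    and T: "biholomorphism T \<Omega> (ball 0 1)" and x0: "x0 \<in> \<Omega>" "T x0 = 0" "(deriv ^^ 2) T x0 = 0"
    and a: "a \<noteq> 0" and \<beta>: "0 < \<beta>" "\<beta> < 1"
    and hyperbolic: "cmod ((deriv ^^ 3) T x0) > 2 * cmod (deriv T x0) ^ 3"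
  shows "\<exists>\<epsilon>0>0. \<exists>C>0. \<forall>\<epsilon>. 0 < \<epsilon> \<and> \<epsilon> \<le> \<epsilon>0 \<longrightarrow>
          (\<exists>z. point_vortex \<Omega> \<gamma> a z \<and> cmod (z 0 - x0) \<le> \<epsilon> \<and>
             exit_time x0 z \<epsilon> \<beta> \<le> ennreal (C * \<bar>ln \<epsilon>\<bar>))"
proof -
  define m where "m = (cmod (deriv T x0))\<^sup>2"
  define s where "s = (deriv ^^ 3) T x0 / deriv T x0"
  have T': "deriv T x0 \<noteq> 0" using biholomorphism_diskD[OF T \<Omega>(1) x0(1)] by simp
  have s: "2 * m < cmod s"
    using hyperbolic T' by (simp add: s_def m_def norm_divide less_divide_eq power2_eq_square power3_eq_cube mult.assoc)
  have m: "0 \<le> m" by (simp add: m_def)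
  then have s0: "s \<noteq> 0" using s by auto
  have F: "(robin_field T has_derivative (\<lambda>h. of_real (2 * m) * h + cnj s * cnj h)) (at x0)"
    unfolding m_def s_def by (rule robin_field_linearization[OF \<Omega>(1) T x0])
  define \<kappa> where "\<kappa> = a / (4 * pi)"
  \<comment> \<open>Half of the spectral gap is spent on the nonlinear error.\<close>
  define \<delta> where "\<delta> = (cmod s - 2 * m) / 2"
  define c where "c = \<bar>\<kappa>\<bar> * (cmod s - 2 * m - \<delta>)"
  have \<delta>: "0 < \<delta>" using s by (simp add: \<delta>_def)
  have "cmod s - 2 * m - \<delta> = \<delta>" unfolding \<delta>_def by argo
  then have c: "0 < c" using \<delta> a by (simp add: c_def \<kappa>_def)
  define \<eta> where "\<eta> = of_real (sgn \<kappa>) * s / of_real (cmod s)"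
  have \<kappa>0: "\<kappa> \<noteq> 0" using a by (simp add: \<kappa>_def)
  have \<eta>: "cmod \<eta> = 1" using \<kappa>0 s0 by (simp add: \<eta>_def norm_mult norm_divide abs_sgn_eq)
  have \<eta>s: "of_real \<kappa> * \<eta> * cnj s = of_real (\<bar>\<kappa>\<bar> * cmod s)"
  proof -
    have "of_real \<kappa> * \<eta> * cnj s = of_real (\<kappa> * sgn \<kappa>) * (s * cnj s) / of_real (cmod s)"
      by (simp add: \<eta>_def)
    also have "\<dots> = of_real (\<bar>\<kappa>\<bar> * cmod s)"
      using s0 unfolding complex_norm_square[symmetric]
      by (simp add: linordered_idom_class.abs_sgn[symmetric] power2_eq_square)
    finally show ?thesis .
  qed
  obtain r where r: "0 < r" and lin: "\<And>h. cmod h < r \<Longrightarrow> x0 + h \<in> \<Omega> \<and>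
      cmod (robin_field T (x0 + h) - (of_real (2 * m) * h + cnj s * cnj h)) \<le> \<delta> * cmod h"
    using linearization_error[OF F stationary_point_conformal(1)[OF \<Omega> G \<gamma> T x0] \<delta> \<Omega>(1) x0(1)] by blast
  \<comment> \<open>A unit vector at which \<open>Im (\<eta> \<omega>\<^sup>2)\<close> attains its maximal value 1.\<close>
  define \<omega> where "\<omega> = csqrt (\<i> / \<eta>)"
  have \<omega>: "cmod \<omega> = 1" "\<eta> * \<omega>\<^sup>2 = \<i>"
    using \<eta> by (auto simp: \<omega>_def norm_divide norm_csqrt)
  \<comment> \<open>The bound 1/2 makes \<open>ln \<epsilon>\<close> negative and \<open>\<epsilon> \<le> \<epsilon> powr \<beta>\<close>; the other one keeps the exit disk inside the region where the linearization is accurate.\<close>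
  define \<epsilon>0 where "\<epsilon>0 = min (1 / 2) ((r / 2) powr (1 / \<beta>))"
  define C where "C = (1 - \<beta>) / c"
  have C: "0 < C" using \<beta> c by (simp add: C_def)
  have \<epsilon>0: "0 < \<epsilon>0" using r by (simp add: \<epsilon>0_def)
  have main: "\<exists>z. point_vortex \<Omega> \<gamma> a z \<and> cmod (z 0 - x0) \<le> \<epsilon> \<and>
      exit_time x0 z \<epsilon> \<beta> \<le> ennreal (C * \<bar>ln \<epsilon>\<bar>)"
    if \<epsilon>: "0 < \<epsilon>" "\<epsilon> \<le> \<epsilon>0" for \<epsilon>
  proof -
    define \<rho> where "\<rho> = \<epsilon> powr \<beta>"
    have "\<rho> \<le> ((r / 2) powr (1 / \<beta>)) powr \<beta>"
      unfolding \<rho>_def using \<epsilon> \<beta> by (intro powr_mono2) (auto simp: \<epsilon>0_def)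
    also have "\<dots> = r / 2" using \<beta> r by (simp add: powr_powr)
    finally have \<rho>r: "\<rho> < r" using r by simp
    have \<epsilon>1: "\<epsilon> < 1" using \<epsilon> by (simp add: \<epsilon>0_def)
    have "\<epsilon> powr 1 \<le> \<epsilon> powr \<beta>" using \<epsilon> \<epsilon>1 \<beta> by (intro powr_mono') auto
    then have "\<epsilon> \<le> \<rho>" using \<epsilon> by (simp add: \<rho>_def)
    then have "x0 + of_real \<epsilon> * \<omega> \<in> \<Omega>"
      using lin[of "of_real \<epsilon> * \<omega>"] \<omega>(1) \<epsilon>(1) \<rho>r by (simp add: norm_mult)
    then obtain z where z: "point_vortex \<Omega> \<gamma> a z" and z0: "z 0 = x0 + of_real \<epsilon> * \<omega>"
      by (rule point_vortex_exists[OF \<Omega> G \<gamma> T])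
    have ode: "(z has_vector_derivative of_real \<kappa> * \<i> * robin_field T (z t)) (at t within {0..})"
      if "0 \<le> t" for t
      using z that vortex_velocity[OF \<Omega> G \<gamma> T, of "z t" a] by (auto simp: point_vortex_def \<kappa>_def)
    have start: "Im (\<eta> * (z 0 - x0)\<^sup>2) = \<epsilon>\<^sup>2"
    proof -
      have "\<eta> * (z 0 - x0)\<^sup>2 = of_real (\<epsilon>\<^sup>2) * (\<eta> * \<omega>\<^sup>2)" by (simp add: z0 power_mult_distrib)
      then show ?thesis using \<omega>(2) by simp
    qed
    have time: "t \<le> C * \<bar>ln \<epsilon>\<bar>"
      if t: "0 \<le> t" and stay: "\<And>u. 0 \<le> u \<Longrightarrow> u \<le> t \<Longrightarrow> cmod (z u - x0) \<le> \<rho>" for t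
    proof -
      have "\<epsilon>\<^sup>2 * exp (2 * c * t) \<le> \<rho>\<^sup>2"
        by (rule saddle_escape_time[OF ode conjunct2[OF lin] m c_def c \<eta> \<eta>s start \<epsilon>(1) stay \<rho>r t])
      then have "ln (\<epsilon>\<^sup>2 * exp (2 * c * t)) \<le> ln (\<rho>\<^sup>2)"
        using \<epsilon>(1) by (intro ln_mono) auto
      then have "2 * ln \<epsilon> + 2 * c * t \<le> 2 * (\<beta> * ln \<epsilon>)"
        using \<epsilon>(1) by (simp add: ln_mult ln_realpow \<rho>_def ln_powr)
      then have "c * t \<le> (1 - \<beta>) * - ln \<epsilon>" by (simp add: algebra_simps)
      then have "t \<le> (1 - \<beta>) * - ln \<epsilon> / c" using c by (simp add: field_simps)
      moreover have "\<bar>ln \<epsilon>\<bar> = - ln \<epsilon>" using \<epsilon>(1) \<epsilon>1 by (simp add: ln_le_zero_iff)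
      ultimately show ?thesis by (simp add: C_def)
    qed
    have "exit_time x0 z \<epsilon> \<beta> \<le> ennreal (C * \<bar>ln \<epsilon>\<bar>)"
      unfolding exit_time_def
      by (rule Sup_least) (auto intro!: ennreal_leI time simp: \<rho>_def)
    moreover have "cmod (z 0 - x0) \<le> \<epsilon>" using z0 \<omega>(1) \<epsilon>(1) by (simp add: norm_mult)
    ultimately show ?thesis
      using z by blast
  qed
  show ?thesis
    by (rule exI[of _ \<epsilon>0], rule conjI, rule \<epsilon>0, rule exI[of _ C], rule conjI, rule C) (use main in blast)
qed

theorem theorem3p1:
  fixes \<Omega> :: "complex set" and G \<gamma> :: "complex \<Rightarrow> complex \<Rightarrow> real"
    and T :: "complex \<Rightarrow> complex" and x0 :: complex and a \<beta> :: real
  assumes "open \<Omega>" and "connected \<Omega>" and "bounded \<Omega>" and "simply_connected \<Omega>"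
    and "C11_boundary \<Omega>"
    and "green_function \<Omega> G" and "regular_part \<Omega> G \<gamma>"
    and "x0 \<in> \<Omega>"
    and "biholomorphism T \<Omega> (ball 0 1)"
    and "T x0 = 0" and "(deriv ^^ 2) T x0 = 0"
    and "a \<noteq> 0"
    and "0 < \<beta>" and "\<beta> < 1"
  shows "stationary_point \<gamma> x0 \<and>
    (cmod ((deriv ^^ 3) T x0) < 2 * cmod (deriv T x0) ^ 3 \<longrightarrow>
       (\<exists>\<epsilon>0>0. \<exists>C>0. \<forall>\<epsilon>. 0 < \<epsilon> \<and> \<epsilon> \<le> \<epsilon>0 \<longrightarrow>
          (\<forall>z. point_vortex \<Omega> \<gamma> a z \<and> z 0 \<in> ball x0 \<epsilon> \<longrightarrow>
             (\<forall>t\<ge>0. z t \<in> ball x0 (C * \<epsilon>)) \<and> exit_time x0 z \<epsilon> \<beta> = \<infinity>))) \<and>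
    (cmod ((deriv ^^ 3) T x0) > 2 * cmod (deriv T x0) ^ 3 \<longrightarrow>
       (\<exists>\<epsilon>0>0. \<exists>C>0. \<forall>\<epsilon>. 0 < \<epsilon> \<and> \<epsilon> \<le> \<epsilon>0 \<longrightarrow>
          (\<exists>z. point_vortex \<Omega> \<gamma> a z \<and> cmod (z 0 - x0) \<le> \<epsilon> \<and>
             exit_time x0 z \<epsilon> \<beta> \<le> ennreal (C * \<bar>ln \<epsilon>\<bar>))))"
proof -
  note conformal = assms(1,3,6,7,9,8,10,11)
  show ?thesis
    by (intro conjI impI stationary_point_conformal(2)[OF conformal]
        point_vortex_stable[OF conformal assms(13,14)]
        point_vortex_unstable[OF conformal assms(12-14)])
qed

end
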